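(* Let $\mathsf{M}$ be a matroid of corank $2$ without coloops, of cardinality $n$ (so $\mathsf{M}$ has rank $n-2$). For each $r$, let $\lambda_r$ denote the number of stressed subsets of rank $r$ and size $r+1$ in $\mathsf{M}$. Then \[ P_{\mathsf{M}}(t) = P_{\mathsf{U}_{n-2,n}}(t)-\sum_{r}\lambda_r\left((n-r-2)P_{\mathsf{U}_{n-2,n-1}}(t)-\sum_{a=2}^{n-r-1}P_{\mathsf{U}_{n-a-1,n-a}}(t)\left(P_{\mathsf{U}_{a-1,a}}(t)+t\,P_{\mathsf{U}_{a-2,a-1}}(t)\right)\right), \] \[ Z_{\mathsf{M}}(t) = Z_{\mathsf{U}_{n-2,n}}(t)-\sum_{r}\lambda_r\left((n-r-2)Z_{\mathsf{U}_{n-2,n-1}}(t)-\sum_{a=2}^{n-r-1}Z_{\mathsf{U}_{a-1,a}}(t)\,Z_{\mathsf{U}_{n-a-1,n-a}}(t)\right). \]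
   Context: $\mathsf{U}_{k,n}$ is the uniform matroid of rank $k$ on $n$ elements. A subset $A$ of the ground set of $\mathsf{M}$ is stressed if both $\mathsf{M}|_A$ and $\mathsf{M}/A$ are uniform matroids. Kazhdan–Lusztig and $Z$-polynomials: there is a unique way to assign to each loopless matroid $\mathsf{M}$ a polynomial $P_{\mathsf{M}}(t)\in\mathbb{Z}[t]$ such that: (i) if $\operatorname{rk}(\mathsf{M})=0$ then $P_{\mathsf{M}}(t)=1$; (ii) if $\operatorname{rk}(\mathsf{M})>0$ then $\deg P_{\mathsf{M}}<\frac12\operatorname{rk}(\mathsf{M})$; (iii) for every loopless $\mathsf{M}$, the polynomial $Z_{\mathsf{M}}(t)=\sum_{F}t^{\operatorname{rk}(F)}P_{\mathsf{M}/F}(t)$, summed over all flats $F$ of $\mathsf{M}$, is palindromic, i.e. $t^{\operatorname{rk}(\mathsf{M})}Z_{\mathsf{M}}(t^{-1})=Z_{\mathsf{M}}(t)$. $P_{\mathsf{M}}$ is the Kazhdan–Lusztig polynomial and $Z_{\mathsf{M}}$ the $Z$-polynomial of $\mathsf{M}$. Convention: for matroids with loops, $P_{\mathsf{M}}=Z_{\mathsf{M}}=0$; in particular $P_{\mathsf{U}_{0,1}}=Z_{\mathsf{U}_{0,1}}=0$. *)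

theory Defs
  imports Complex_Main "HOL-Computational_Algebra.Polynomial"
begin

section \<open>Finite matroids\<close>

definition is_matroid :: "'a set \<Rightarrow> 'a set set \<Rightarrow> bool" where
  "is_matroid E I \<longleftrightarrow>
     finite E \<and> (\<forall>X\<in>I. X \<subseteq> E) \<and> {} \<in> I \<and>
     (\<forall>X\<in>I. \<forall>Y. Y \<subseteq> X \<longrightarrow> Y \<in> I) \<and>
     (\<forall>X\<in>I. \<forall>Y\<in>I. card X < card Y \<longrightarrow> (\<exists>e\<in>Y - X. insert e X \<in> I))"

typedef 'a matroid = "{(E :: 'a set, I :: 'a set set). is_matroid E I}"
  by (rule exI[of _ "({}, {{}})"]) (auto simp: is_matroid_def)

setup_lifting type_definition_matroid

lift_definition ground :: "'a matroid \<Rightarrow> 'a set" is fst .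

lift_definition indep :: "'a matroid \<Rightarrow> 'a set \<Rightarrow> bool" is "\<lambda>(E, I) X. X \<in> I" .

definition rank_of :: "'a matroid \<Rightarrow> 'a set \<Rightarrow> nat" where
  "rank_of M A = Max (card ` {X. X \<subseteq> A \<and> indep M X})"

definition rank :: "'a matroid \<Rightarrow> nat" where
  "rank M = rank_of M (ground M)"

definition corank :: "'a matroid \<Rightarrow> nat" where
  "corank M = card (ground M) - rank M"

definition basis_of :: "'a matroid \<Rightarrow> 'a set \<Rightarrow> 'a set \<Rightarrow> bool" where
  "basis_of M A B \<longleftrightarrow> B \<subseteq> A \<and> indep M B \<and> (\<forall>e\<in>A - B. \<not> indep M (insert e B))"

definition loop :: "'a matroid \<Rightarrow> 'a \<Rightarrow> bool" where
  "loop M e \<longleftrightarrow> e \<in> ground M \<and> \<not> indep M {e}"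

definition loopless :: "'a matroid \<Rightarrow> bool" where
  "loopless M \<longleftrightarrow> (\<forall>e. \<not> loop M e)"

definition coloop :: "'a matroid \<Rightarrow> 'a \<Rightarrow> bool" where
  "coloop M e \<longleftrightarrow> e \<in> ground M \<and> (\<forall>B. basis_of M (ground M) B \<longrightarrow> e \<in> B)"

definition flat :: "'a matroid \<Rightarrow> 'a set \<Rightarrow> bool" where
  "flat M F \<longleftrightarrow> F \<subseteq> ground M \<and> (\<forall>e\<in>ground M - F. rank_of M F < rank_of M (insert e F))"

lemma is_matroid_ground: "is_matroid (ground M) {X. indep M X}"
  by transfer auto

lemma finite_ground [simp]: "finite (ground M)"
  and indep_subset_ground: "indep M X \<Longrightarrow> X \<subseteq> ground M"
  and indep_empty [simp]: "indep M {}"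
  and indep_mono: "indep M X \<Longrightarrow> Y \<subseteq> X \<Longrightarrow> indep M Y"
  and indep_augment:
    "indep M X \<Longrightarrow> indep M Y \<Longrightarrow> card X < card Y \<Longrightarrow> \<exists>e\<in>Y - X. indep M (insert e X)"
proof -
  note * = is_matroid_ground[of M, unfolded is_matroid_def mem_Collect_eq]
  show "finite (ground M)" using * by (rule conjunct1)
  show "X \<subseteq> ground M" if "indep M X"
    using conjunct1[OF conjunct2[OF *]] that by simp
  show "indep M {}" using conjunct1[OF conjunct2[OF conjunct2[OF *]]] .
  show "indep M Y" if "indep M X" "Y \<subseteq> X"
    using conjunct1[OF conjunct2[OF conjunct2[OF conjunct2[OF *]]]] that by simp
  show "\<exists>e\<in>Y - X. indep M (insert e X)" if "indep M X" "indep M Y" "card X < card Y"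
    using conjunct2[OF conjunct2[OF conjunct2[OF conjunct2[OF *]]]] that by simp
qed

lemma indep_finite: "indep M X \<Longrightarrow> finite X"
  using indep_subset_ground finite_subset finite_ground by metis

lemma matroid_eqI:
  assumes "ground M = ground N" "\<And>X. indep M X \<longleftrightarrow> indep N X"
  shows "M = N"
  using assms by transfer auto

lemma finite_indep_subsets: "finite {X. X \<subseteq> A \<and> indep M X}"
  by (rule finite_subset[of _ "Pow (ground M)"]) (auto dest: indep_subset_ground)

lemma rank_of_ge: "X \<subseteq> A \<Longrightarrow> indep M X \<Longrightarrow> card X \<le> rank_of M A"
  unfolding rank_of_def by (rule Max_ge) (auto intro: finite_indep_subsets)

lemma rank_of_attained: "\<exists>X. X \<subseteq> A \<and> indep M X \<and> card X = rank_of M A"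
proof -
  have "rank_of M A \<in> card ` {X. X \<subseteq> A \<and> indep M X}"
    unfolding rank_of_def
    by (rule Max_in) (use finite_indep_subsets[of A M] in \<open>auto intro: exI[of _ "{}"]\<close>)
  then show ?thesis by auto
qed

lemma card_basis_of: "basis_of M A B \<Longrightarrow> card B = rank_of M A"
proof -
  assume B: "basis_of M A B"
  obtain X where X: "X \<subseteq> A" "indep M X" "card X = rank_of M A"
    using rank_of_attained by metis
  have "\<not> card B < card X"
  proof
    assume "card B < card X"
    then obtain e where "e \<in> X - B" "indep M (insert e B)"
      using indep_augment B X(2) unfolding basis_of_def by metis
    with B X(1) show False unfolding basis_of_def by blast
  qed
  moreover have "card B \<le> rank_of M A"
    using B unfolding basis_of_def by (intro rank_of_ge) auto
  ultimately show ?thesis using X(3) by simp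
qed

lemma basis_ofI: "B \<subseteq> A \<Longrightarrow> indep M B \<Longrightarrow> card B = rank_of M A \<Longrightarrow> basis_of M A B"
proof -
  assume B: "B \<subseteq> A" "indep M B" "card B = rank_of M A"
  have "\<not> indep M (insert e B)" if "e \<in> A - B" for e
  proof
    assume "indep M (insert e B)"
    then have "card (insert e B) \<le> rank_of M A"
      using that B(1) by (intro rank_of_ge) auto
    then show False using B that indep_finite[OF B(2)] by simp
  qed
  then show ?thesis using B unfolding basis_of_def by auto
qed

lemma basis_of_exists: "\<exists>B. basis_of M A B"
  using rank_of_attained[of A M] basis_ofI by metis


section \<open>Restriction, contraction and uniform matroids\<close>

lemma is_matroid_restrict:
  assumes "is_matroid E I"
  shows "is_matroid (E \<inter> A) {X \<in> I. X \<subseteq> A}"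
  unfolding is_matroid_def
proof (intro conjI ballI allI impI)
  fix X Y assume *: "X \<in> {X \<in> I. X \<subseteq> A}" "Y \<in> {X \<in> I. X \<subseteq> A}" "card X < card Y"
  then have XY: "X \<in> I" "Y \<in> I" by simp_all
  have "\<forall>X\<in>I. \<forall>Y\<in>I. card X < card Y \<longrightarrow> (\<exists>e\<in>Y - X. insert e X \<in> I)"
    using assms unfolding is_matroid_def by simp
  from this[rule_format, OF XY *(3)]
  obtain e where "e \<in> Y - X" "insert e X \<in> I" ..
  with * show "\<exists>e\<in>Y - X. insert e X \<in> {X \<in> I. X \<subseteq> A}" by blast
next
  fix X assume "X \<in> {X \<in> I. X \<subseteq> A}"
  moreover have "\<forall>X\<in>I. X \<subseteq> E" using assms unfolding is_matroid_def by simp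
  ultimately show "X \<subseteq> E \<inter> A" by blast
next
  fix X Y assume "X \<in> {X \<in> I. X \<subseteq> A}" "Y \<subseteq> X"
  moreover have "\<forall>X\<in>I. \<forall>Y. Y \<subseteq> X \<longrightarrow> Y \<in> I" using assms unfolding is_matroid_def by simp
  ultimately show "Y \<in> {X \<in> I. X \<subseteq> A}" by blast
qed (use assms in \<open>simp_all add: is_matroid_def\<close>)

lift_definition restrict :: "'a matroid \<Rightarrow> 'a set \<Rightarrow> 'a matroid" is
  "\<lambda>(E, I) A. (E \<inter> A, {X \<in> I. X \<subseteq> A})"
  by (simp only: split_beta mem_Collect_eq fst_conv snd_conv is_matroid_restrict)

lemma is_matroid_contract:
  "is_matroid (ground M - A)
     {X. X \<subseteq> ground M - A \<and> (\<exists>B. basis_of M A B \<and> indep M (X \<union> B))}" (is "is_matroid ?E ?I")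
  unfolding is_matroid_def
proof (intro conjI ballI allI impI)
  show "{} \<in> ?I"
    using basis_of_exists[of M A] by (auto simp: basis_of_def)
next
  fix X Y assume "X \<in> ?I" "Y \<subseteq> X"
  then show "Y \<in> ?I"
    by (auto intro: indep_mono)
next
  fix X Y assume X: "X \<in> ?I" and Y: "Y \<in> ?I" and less: "card X < card Y"
  obtain B C where B: "basis_of M A B" "indep M (X \<union> B)"
    and C: "basis_of M A C" "indep M (Y \<union> C)"
    using X Y by auto
  have "card (X \<union> B) = card X + card B" "card (Y \<union> C) = card Y + card C"
    using X Y B C indep_finite[OF B(2)] indep_finite[OF C(2)]
    by (auto intro!: card_Un_disjoint simp: basis_of_def)
  then have "card (X \<union> B) < card (Y \<union> C)"
    using less card_basis_of[OF B(1)] card_basis_of[OF C(1)] by simp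
  then obtain e where e: "e \<in> (Y \<union> C) - (X \<union> B)" "indep M (insert e (X \<union> B))"
    using indep_augment B(2) C(2) by metis
  have "e \<notin> C"
  proof
    assume "e \<in> C"
    then have "e \<in> A - B" using e C(1) by (auto simp: basis_of_def)
    moreover have "indep M (insert e B)" using e(2) by (rule indep_mono) auto
    ultimately show False using B(1) by (auto simp: basis_of_def)
  qed
  then have "e \<in> Y - X" using e by auto
  moreover have "insert e X \<in> ?I" using e B X Y \<open>e \<notin> C\<close> by auto
  ultimately show "\<exists>e\<in>Y - X. insert e X \<in> ?I" by blast
qed auto

definition contract :: "'a matroid \<Rightarrow> 'a set \<Rightarrow> 'a matroid" where
  "contract M A = Abs_matroid (ground M - A,
     {X. X \<subseteq> ground M - A \<and> (\<exists>B. basis_of M A B \<and> indep M (X \<union> B))})"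

lemma ground_contract: "ground (contract M A) = ground M - A"
  and indep_contract: "indep (contract M A) X \<longleftrightarrow>
    X \<subseteq> ground M - A \<and> (\<exists>B. basis_of M A B \<and> indep M (X \<union> B))"
  using is_matroid_contract[of M A]
  by (auto simp: contract_def ground.rep_eq indep.rep_eq Abs_matroid_inverse)

text \<open>For an infinite set \<open>E\<close> the value is the empty matroid.\<close>

lift_definition uniform_on :: "nat \<Rightarrow> 'a set \<Rightarrow> 'a matroid" is
  "\<lambda>k E. if finite E then (E, {X. X \<subseteq> E \<and> card X \<le> k}) else ({}, {{}})"
proof -
  fix k and E :: "'a set"
  have aug: "\<exists>e\<in>Y - X. insert e X \<subseteq> E \<and> card (insert e X) \<le> k"
    if "finite E" "X \<subseteq> E" "Y \<subseteq> E" "card Y \<le> k" "card X < card Y" for X Y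
  proof -
    have fin: "finite X" "finite Y" using that finite_subset by auto
    then have "\<not> Y \<subseteq> X" using that card_mono[of X Y] by auto
    then obtain e where "e \<in> Y - X" by auto
    then show ?thesis using that fin by (intro bexI[of _ e]) auto
  qed
  have mono: "card Y \<le> k" if "finite E" "X \<subseteq> E" "card X \<le> k" "Y \<subseteq> X" for X Y
    using that card_mono[of X Y] finite_subset[of X E] by auto
  have "is_matroid E {X. X \<subseteq> E \<and> card X \<le> k}" if "finite E"
    unfolding is_matroid_def
  proof (intro conjI ballI allI impI)
    fix X Y assume "X \<in> {X. X \<subseteq> E \<and> card X \<le> k}" "Y \<in> {X. X \<subseteq> E \<and> card X \<le> k}"
      "card X < card Y"
    then show "\<exists>e\<in>Y - X. insert e X \<in> {X. X \<subseteq> E \<and> card X \<le> k}"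
      using aug[OF that, of X Y] by simp
  next
    fix X Y assume "X \<in> {X. X \<subseteq> E \<and> card X \<le> k}" "Y \<subseteq> X"
    then show "Y \<in> {X. X \<subseteq> E \<and> card X \<le> k}"
      using mono[OF that, of X Y] by auto
  qed (use that in auto)
  moreover have "is_matroid {} {{} :: 'a set}"
    by (auto simp: is_matroid_def)
  ultimately show "(if finite E then (E, {X. X \<subseteq> E \<and> card X \<le> k}) else ({}, {{}}))
      \<in> {(E, I). is_matroid E I}"
    by auto
qed

abbreviation U :: "nat \<Rightarrow> nat \<Rightarrow> nat matroid" where
  "U k n \<equiv> uniform_on k {..<n}"

definition uniform :: "'a matroid \<Rightarrow> bool" where
  "uniform M \<longleftrightarrow> (\<exists>k\<le>card (ground M). M = uniform_on k (ground M))"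

definition stressed :: "'a matroid \<Rightarrow> 'a set \<Rightarrow> bool" where
  "stressed M A \<longleftrightarrow> A \<subseteq> ground M \<and> uniform (restrict M A) \<and> uniform (contract M A)"

definition num_stressed :: "'a matroid \<Rightarrow> nat \<Rightarrow> nat" where
  "num_stressed M r = card {A. stressed M A \<and> rank_of M A = r \<and> card A = r + 1}"


section \<open>Kazhdan--Lusztig polynomials and Z-polynomials\<close>

text \<open>
  The identity \<open>t^d p(1/t) = p(t)\<close> of Laurent polynomials, compared coefficientwise. The
  first clause is not redundant: without it, terms of degree above \<open>d\<close>, which become negative
  powers of \<open>t\<close> on the left-hand side, would be ignored.
\<close>

definition palindromic :: "nat \<Rightarrow> int poly \<Rightarrow> bool" where
  "palindromic d p \<longleftrightarrow> degree p \<le> d \<and> (\<forall>i\<le>d. coeff p i = coeff p (d - i))"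

lemma palindromic_iff_poly:
  "palindromic d p \<longleftrightarrow>
     (\<forall>t::real. t \<noteq> 0 \<longrightarrow> t ^ d * poly (map_poly of_int p) (1 / t) = poly (map_poly of_int p) t)"
proof -
  define q :: "real poly" where "q = map_poly of_int p"
  define N where "N = degree q"
  have cq: "coeff q i = of_int (coeff p i)" for i
    by (simp add: q_def coeff_map_poly)
  have N: "N = degree p" unfolding N_def q_def by (rule degree_map_poly) simp
  have ev: "(t ^ d * poly q (1 / t) = poly q t) \<longleftrightarrow>
      poly (monom 1 d * reflect_poly q) t = poly (monom 1 N * q) t" if "t \<noteq> 0" for t
    using that by (simp add: poly_monom poly_reflect_poly_nz N_def inverse_eq_divide)
  have "(\<forall>t. t \<noteq> 0 \<longrightarrow> t ^ d * poly q (1 / t) = poly q t) \<longleftrightarrow>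
      monom 1 d * reflect_poly q = monom 1 N * q"
  proof
    assume H: "\<forall>t. t \<noteq> 0 \<longrightarrow> t ^ d * poly q (1 / t) = poly q t"
    define D where "D = monom 1 d * reflect_poly q - monom 1 N * q"
    have "UNIV - {0} \<subseteq> {t. poly D t = 0}" using H ev by (auto simp: D_def)
    moreover have "infinite (UNIV - {0::real})" by (simp add: infinite_UNIV_char_0)
    ultimately have "D = 0" using poly_roots_finite[of D] finite_subset by blast
    then show "monom 1 d * reflect_poly q = monom 1 N * q" by (simp add: D_def)
  qed (use ev in auto)
  also have "\<dots> \<longleftrightarrow> palindromic d p"
  proof
    assume "palindromic d p"
    then have deg: "N \<le> d" and sym: "\<And>i. i \<le> d \<Longrightarrow> coeff q i = coeff q (d - i)"
      unfolding palindromic_def N cq of_int_eq_iff by blast+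
    show "monom 1 d * reflect_poly q = monom 1 N * q"
    proof (rule poly_eqI)
      fix k
      have "coeff q (k - N) = 0" if "N \<le> k" "k < d" "d - (k - N) > N"
        using that sym[of "k - N"] by (simp add: coeff_eq_0 N_def)
      moreover have "coeff q (k - N) = 0" if "N \<le> k" "k - N > N"
        using that by (simp add: coeff_eq_0 N_def)
      moreover have "coeff q (N - (k - d)) = coeff q (k - N)" if "d \<le> k" "k - d \<le> N"
      proof -
        have "k - N \<le> d" "d - (k - N) = N - (k - d)" using that deg by auto
        then show ?thesis using sym[of "k - N"] by simp
      qed
      moreover have "N \<le> k" if "d \<le> k" using that deg by simp
      ultimately show "coeff (monom 1 d * reflect_poly q) k = coeff (monom 1 N * q) k"
        using deg by (auto simp: coeff_monom_mult coeff_reflect_poly N_def[symmetric])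
    qed
  next
    assume eq: "monom 1 d * reflect_poly q = monom 1 N * q"
    show "palindromic d p"
    proof (cases "p = 0")
      case False
      then have "coeff q N \<noteq> 0" by (simp add: N cq)
      then have "coeff (monom 1 d * reflect_poly q) d \<noteq> 0"
        by (simp add: coeff_monom_mult N_def)
      then have "coeff (monom 1 N * q) d \<noteq> 0" using eq by simp
      then have deg: "N \<le> d" by (auto simp: coeff_monom_mult split: if_splits)
      have "coeff q i = coeff q (d - i)" if "i \<le> d" for i
      proof -
        have "coeff (monom 1 d * reflect_poly q) (N + i) = coeff q i"
          unfolding eq by (simp add: coeff_monom_mult)
        moreover have "coeff q (d - i) = 0" if "N + i < d"
          using that by (simp add: coeff_eq_0 N_def)
        moreover have "coeff q (d - i) = coeff q (N - (N + i - d))" if "d \<le> N + i" "i \<le> d"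
          using that deg by (intro arg_cong[of _ _ "coeff q"]) auto
        moreover have "N + i - d \<le> N" using \<open>i \<le> d\<close> by simp
        ultimately show ?thesis using \<open>i \<le> d\<close>
          by (auto simp: coeff_monom_mult coeff_reflect_poly N_def[symmetric] split: if_splits)
      qed
      then show ?thesis using deg unfolding palindromic_def N cq of_int_eq_iff by blast
    qed (simp add: palindromic_def)
  qed
  finally show ?thesis by (simp add: q_def)
qed

definition flat_sum :: "('a matroid \<Rightarrow> int poly) \<Rightarrow> 'a matroid \<Rightarrow> int poly" where
  "flat_sum P M = (\<Sum>F | flat M F. monom 1 (rank_of M F) * P (contract M F))"

definition KL_assignment :: "('a matroid \<Rightarrow> int poly) \<Rightarrow> bool" where
  "KL_assignment P \<longleftrightarrow>
     (\<forall>M. loopless M \<and> rank M = 0 \<longrightarrow> P M = 1) \<and>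
     (\<forall>M. loopless M \<and> rank M > 0 \<longrightarrow> 2 * degree (P M) < rank M) \<and>
     (\<forall>M. loopless M \<longrightarrow> palindromic (rank M) (flat_sum P M)) \<and>
     (\<forall>M. \<not> loopless M \<longrightarrow> P M = 0)"

text \<open>The description is proper by \<open>ex1_KL_assignment\<close> below.\<close>

definition KL :: "'a matroid \<Rightarrow> int poly" where
  "KL = (THE P. KL_assignment P)"

definition Zpoly :: "'a matroid \<Rightarrow> int poly" where
  "Zpoly M = (if loopless M then flat_sum KL M else 0)"


subsection \<open>Existence and uniqueness\<close>

lemma finite_flats: "finite {F. flat M F}"
  by (rule finite_subset[of _ "Pow (ground M)"]) (auto simp: flat_def)

lemma loopless_indep: "loopless M \<Longrightarrow> e \<in> ground M \<Longrightarrow> indep M {e}"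
  by (auto simp: loopless_def loop_def)

lemma rank_of_empty [simp]: "rank_of M {} = 0"
  using rank_of_attained[of "{}" M] by auto

lemma flat_empty: "loopless M \<Longrightarrow> flat M {}"
  unfolding flat_def
proof (intro conjI ballI)
  fix e assume "loopless M" "e \<in> ground M - {}"
  then have "card {e} \<le> rank_of M {e}" by (intro rank_of_ge loopless_indep) auto
  then show "rank_of M {} < rank_of M {e}" by simp
qed auto

lemma contract_empty: "contract M {} = M"
proof (rule matroid_eqI)
  fix X
  show "indep (contract M {}) X \<longleftrightarrow> indep M X"
    by (auto simp: indep_contract basis_of_def dest: indep_subset_ground)
qed (simp add: ground_contract)

lemma loopless_contract_flat:
  assumes "flat M F" shows "loopless (contract M F)"
  unfolding loopless_def loop_def ground_contract
proof (intro allI notI, elim conjE)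
  fix e assume e: "e \<in> ground M - F" and *: "\<not> indep (contract M F) {e}"
  obtain B where B: "basis_of M F B" using basis_of_exists by metis
  obtain C where C: "C \<subseteq> insert e F" "indep M C" "card C = rank_of M (insert e F)"
    using rank_of_attained by metis
  have "card B < card C"
    using assms e C(3) card_basis_of[OF B] by (auto simp: flat_def)
  then obtain x where x: "x \<in> C - B" "indep M (insert x B)"
    using indep_augment B C(2) unfolding basis_of_def by metis
  then have "x = e" using B C(1) unfolding basis_of_def by blast
  with x e B * show False by (auto simp: indep_contract)
qed

lemma rank_contract_le:
  assumes "F \<subseteq> ground M" shows "rank_of M F + rank (contract M F) \<le> rank M"
proof -
  obtain X where X: "indep (contract M F) X" "card X = rank (contract M F)"
    using rank_of_attained unfolding rank_def by metis
  then obtain B where B: "basis_of M F B" "indep M (X \<union> B)" "X \<subseteq> ground M - F"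
    by (auto simp: indep_contract)
  have "card (X \<union> B) = card X + card B"
    using B indep_finite[OF B(2)] by (intro card_Un_disjoint) (auto simp: basis_of_def)
  moreover have "card (X \<union> B) \<le> rank M"
    unfolding rank_def using B(2) by (intro rank_of_ge) (auto dest: indep_subset_ground)
  ultimately show ?thesis using X(2) card_basis_of[OF B(1)] by simp
qed

lemma rank_0_ground: "loopless M \<Longrightarrow> rank M = 0 \<Longrightarrow> ground M = {}"
proof (rule ccontr)
  assume *: "loopless M" "rank M = 0" "ground M \<noteq> {}"
  then obtain e where e: "e \<in> ground M" by auto
  then have "card {e} \<le> rank M"
    unfolding rank_def using * by (intro rank_of_ge loopless_indep) auto
  then show False using * by simp
qed

lemma card_ground_contract:
  "flat M F \<Longrightarrow> F \<noteq> {} \<Longrightarrow> card (ground (contract M F)) < card (ground M)"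
  by (auto simp: ground_contract flat_def intro!: psubset_card_mono)

lemma flat_sum_split:
  assumes "loopless M"
  shows "flat_sum P M =
    P M + (\<Sum>F | flat M F \<and> F \<noteq> {}. monom 1 (rank_of M F) * P (contract M F))"
proof -
  have "{F. flat M F} = insert {} {F. flat M F \<and> F \<noteq> {}}"
    using flat_empty[OF assms] by auto
  moreover have "finite {F. flat M F \<and> F \<noteq> {}}"
    using finite_flats[of M] by (rule rev_finite_subset) auto
  ultimately show ?thesis
    by (simp add: flat_sum_def contract_empty flip: one_pCons)
qed

lemma KL_assignment_unique:
  assumes "KL_assignment P" "KL_assignment Q"
  shows "P M = Q M"
proof (induction "card (ground M)" arbitrary: M rule: less_induct)
  case less
  show ?case
  proof (cases "loopless M \<and> rank M > 0")
    case True
    have eq: "(\<Sum>F | flat M F \<and> F \<noteq> {}. monom 1 (rank_of M F) * P (contract M F)) =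
        (\<Sum>F | flat M F \<and> F \<noteq> {}. monom 1 (rank_of M F) * Q (contract M F))"
      using less card_ground_contract by (intro sum.cong) auto
    define D where "D = P M - Q M"
    have D: "D = flat_sum P M - flat_sum Q M"
      using True eq by (simp add: D_def flat_sum_split)
    have pal: "palindromic (rank M) (flat_sum P M)" "palindromic (rank M) (flat_sum Q M)"
      and deg: "2 * degree (P M) < rank M" "2 * degree (Q M) < rank M"
      using assms True by (auto simp: KL_assignment_def)
    have small: "coeff D i = 0" if "2 * i \<ge> rank M" for i
      using deg that by (simp add: D_def coeff_eq_0)
    have "coeff D i = 0" for i
    proof (cases "2 * i \<ge> rank M")
      case False
      then have "coeff D i = coeff D (rank M - i)"
        unfolding D coeff_diff using pal unfolding palindromic_def
        by (metis mult_2 nat_le_linear not_less trans_le_add1 order.trans)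
      also have "\<dots> = 0" using False by (intro small) simp
      finally show ?thesis .
    qed (rule small)
    then have "D = 0" by (simp add: poly_eq_iff)
    then show ?thesis by (simp add: D_def)
  next
    case False
    then show ?thesis
      using assms unfolding KL_assignment_def by (metis gr0I)
  qed
qed

definition KL_part :: "nat \<Rightarrow> int poly \<Rightarrow> int poly" where
  "KL_part d R = (\<Sum>i | 2 * i < d. monom (coeff R (d - i) - coeff R i) i)"

lemma coeff_KL_part:
  "coeff (KL_part d R) i = (if 2 * i < d then coeff R (d - i) - coeff R i else 0)"
proof -
  have "finite {i. 2 * i < d}" by (rule finite_subset[of _ "{..d}"]) auto
  then show ?thesis by (simp add: KL_part_def coeff_sum)
qed

lemma degree_KL_part: "d > 0 \<Longrightarrow> 2 * degree (KL_part d R) < d"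
proof (cases "KL_part d R = 0")
  case False
  then have "coeff (KL_part d R) (degree (KL_part d R)) \<noteq> 0" by simp
  then show ?thesis by (auto simp: coeff_KL_part split: if_splits)
qed auto

lemma palindromic_KL_part:
  assumes "degree R \<le> d" shows "palindromic d (KL_part d R + R)"
  unfolding palindromic_def
proof (intro conjI allI impI)
  have "degree (KL_part d R) \<le> d"
    by (rule degree_le) (auto simp: coeff_KL_part)
  then show "degree (KL_part d R + R) \<le> d"
    using assms by (rule degree_add_le)
next
  fix i assume "i \<le> d"
  moreover have "d - i = i" if "2 * i = d" using that by simp
  ultimately show "coeff (KL_part d R + R) i = coeff (KL_part d R + R) (d - i)"
    by (cases "2 * i" d rule: linorder_cases) (auto simp: coeff_KL_part)
qed

function KL_rec :: "'a matroid \<Rightarrow> int poly" where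
  "KL_rec M =
     (if \<not> loopless M then 0 else if rank M = 0 then 1
      else KL_part (rank M)
        (\<Sum>F | flat M F \<and> F \<noteq> {}. monom 1 (rank_of M F) * KL_rec (contract M F)))"
  by auto
termination
  by (relation "measure (\<lambda>M. card (ground M))") (auto simp: card_ground_contract)

declare KL_rec.simps [simp del]

lemma degree_KL_rec: "rank M > 0 \<Longrightarrow> 2 * degree (KL_rec M) < rank M"
  by (subst KL_rec.simps) (auto simp: degree_KL_part)

lemma KL_assignment_KL_rec: "KL_assignment KL_rec"
  unfolding KL_assignment_def
proof (intro conjI allI impI)
  fix M :: "'a matroid"
  assume M: "loopless M"
  define R where
    "R = (\<Sum>F | flat M F \<and> F \<noteq> {}. monom 1 (rank_of M F) * KL_rec (contract M F))"
  have split: "flat_sum KL_rec M = KL_rec M + R"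
    using M by (simp add: flat_sum_split R_def)
  show "palindromic (rank M) (flat_sum KL_rec M)"
  proof (cases "rank M = 0")
    case True
    then have "{F. flat M F \<and> F \<noteq> {}} = {}"
      using rank_0_ground[OF M] by (auto simp: flat_def)
    then have "R = 0" by (simp only: R_def sum.empty)
    then show ?thesis using True M by (simp add: split KL_rec.simps palindromic_def)
  next
    case False
    have "degree (monom 1 (rank_of M F) * KL_rec (contract M F)) \<le> rank M"
      if F: "flat M F" for F
    proof -
      have "degree (KL_rec (contract M F)) \<le> rank (contract M F)"
      proof (cases "rank (contract M F) = 0")
        case True
        then show ?thesis by (subst KL_rec.simps) auto
      qed (use degree_KL_rec[of "contract M F"] in auto)
      then show ?thesis
        using rank_contract_le[of F M] F degree_mult_le[of "monom 1 (rank_of M F)" "KL_rec (contract M F)"]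
        by (auto simp: flat_def degree_monom_eq)
    qed
    then have "degree R \<le> rank M"
      unfolding R_def using finite_flats[of M]
      by (intro degree_sum_le) (auto elim: rev_finite_subset)
    moreover have "KL_rec M = KL_part (rank M) R"
      using False M by (subst KL_rec.simps) (simp add: R_def)
    ultimately show ?thesis
      by (simp add: split palindromic_KL_part)
  qed
next
  fix M :: "'a matroid"
  assume "loopless M \<and> rank M = 0"
  then show "KL_rec M = 1" by (subst KL_rec.simps) auto
next
  fix M :: "'a matroid"
  assume "\<not> loopless M"
  then show "KL_rec M = 0" by (subst KL_rec.simps) auto
qed (auto intro: degree_KL_rec)

theorem ex1_KL_assignment: "\<exists>!P :: 'a matroid \<Rightarrow> int poly. KL_assignment P"
  using KL_assignment_KL_rec KL_assignment_unique by (metis ext)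

lemma KL_assignment_KL: "KL_assignment KL"
  unfolding KL_def by (rule theI'[OF ex1_KL_assignment])

end

theory Submission
  imports Defs
begin

text \<open>
  The dual of a coloopless matroid \<open>M\<close> of corank two has rank two and no loops, so it is determined
  by its parallel classes: a set is independent in \<open>M\<close> iff its complement meets two classes. The
  stressed sets of nullity one are the complements of the classes, and contracting to a subset \<open>S\<close>
  gives again such a matroid (\<open>S\<close> meets two classes) or a uniform matroid of corank one (\<open>S\<close> lies
  in one class).

  Multiplied by \<open>t\<^sup>2\<close>, the claimed value of \<open>KL M\<close> is a sum over the classes of a function
  \<open>D (b, n - b)\<close> of the class size \<open>b\<close> whose increments along antidiagonals are explicit
  quadratic expressions in the corank-one polynomials. Summing over flats is a binomial transform in
  both variables; it commutes with the antidiagonal increments and turns the corank-one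
  KL polynomials into the corank-one Z-polynomials. Hence the sum over flats of the claimed
  values is the claimed value of \<open>Zpoly M\<close>, which is visibly palindromic, and induction together
  with the uniqueness of KL polynomials concludes. The uniform matroid \<open>U (n - 2) n\<close> is the case
  where all classes are singletons.
\<close>

section \<open>Binomial transforms\<close>

text \<open>The closed form is \<open>bt t a n = (\<Sum>s\<le>n. (n choose s) * t ^ (n - s) * a s)\<close>.\<close>

primrec bt :: "'r::comm_ring_1 \<Rightarrow> (nat \<Rightarrow> 'r) \<Rightarrow> nat \<Rightarrow> 'r" where
  "bt t a 0 = a 0"
| "bt t a (Suc n) = t * bt t a n + bt t (\<lambda>s. a (Suc s)) n"

text \<open>The pair \<open>(j, k)\<close> is weighted by the subsets of a disjoint union of parts
  of sizes \<open>b\<close> and \<open>c\<close> that meet the parts in \<open>j\<close> and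
  \<open>k\<close> elements, with \<open>t\<close> counting the omitted elements.\<close>

definition bt2 :: "'r::comm_ring_1 \<Rightarrow> (nat \<Rightarrow> nat \<Rightarrow> 'r) \<Rightarrow> nat \<Rightarrow> nat \<Rightarrow> 'r" where
  "bt2 t d b c = bt t (\<lambda>j. bt t (d j) c) b"

lemma bt_add: "bt t (\<lambda>s. a s + a' s) n = bt t a n + bt t a' n"
  by (induction n arbitrary: a a') (simp_all add: algebra_simps)

lemma bt_mult_left: "bt t (\<lambda>s. x * a s) n = x * bt t a n"
  by (induction n arbitrary: a) (simp_all add: algebra_simps)

lemma bt_diff: "bt t (\<lambda>s. a s - a' s) n = bt t a n - bt t a' n"
  using bt_add[of t "\<lambda>s. a s - a' s" a' n] by (simp add: eq_diff_eq)

lemma bt2_Suc_left: "bt2 t d (Suc b) c = t * bt2 t d b c + bt2 t (\<lambda>j. d (Suc j)) b c"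
  by (simp add: bt2_def)

lemma bt2_Suc_right: "bt2 t d b (Suc c) = t * bt2 t d b c + bt2 t (\<lambda>j k. d j (Suc k)) b c"
  by (simp add: bt2_def bt_add bt_mult_left)

lemma bt2_add: "bt2 t (\<lambda>j k. d j k + d' j k) b c = bt2 t d b c + bt2 t d' b c"
  by (simp add: bt2_def bt_add)

lemma bt2_diff: "bt2 t (\<lambda>j k. d j k - d' j k) b c = bt2 t d b c - bt2 t d' b c"
  by (simp add: bt2_def bt_diff)

text \<open>A weight that depends only on the total size does not see the two parts: Vandermonde's
  identity.\<close>

lemma bt2_plus_arg: "bt2 t (\<lambda>j k. a (j + k)) b c = bt t a (b + c)"
proof (induction b arbitrary: a)
  case 0
  then show ?case by (simp add: bt2_def)
next
  case (Suc b)
  then show ?case using Suc[of "\<lambda>s. a (Suc s)"] by (simp add: bt2_Suc_left)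
qed

lemma bt2_prod: "bt2 t (\<lambda>j k. u j * v k) b c = bt t u b * bt t v c"
  using bt_mult_left[of t "bt t v c" u b] by (simp add: bt2_def bt_mult_left mult.commute)

section \<open>Sums over all subsets of a finite set\<close>

lemma sum_Pow_insert:
  fixes g :: "'a set \<Rightarrow> 'b::comm_monoid_add"
  assumes "finite E" "x \<notin> E"
  shows "(\<Sum>S\<in>Pow (insert x E). g S) = (\<Sum>S\<in>Pow E. g S) + (\<Sum>S\<in>Pow E. g (insert x S))"
proof -
  have "inj_on (insert x) (Pow E)" using assms by (auto simp: inj_on_def)
  moreover have "Pow E \<inter> insert x ` Pow E = {}" using assms by auto
  ultimately show ?thesis using assms
    by (simp add: Pow_insert sum.union_disjoint sum.reindex)
qed

text \<open>Subsets avoiding a new element gain a factor \<open>t\<close>, the others enlarge the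
  trace on \<open>B\<close> or off \<open>B\<close>; this is the recursion of
  \<open>bt2\<close>.\<close>

lemma sum_Pow_bt2:
  assumes "finite E"
  shows "(\<Sum>S\<in>Pow E. t ^ card (E - S) * d (card (S \<inter> B)) (card (S - B)))
    = bt2 t d (card (E \<inter> B)) (card (E - B))"
  using assms
proof (induction E arbitrary: d)
  case empty
  then show ?case by (simp add: bt2_def)
next
  case (insert x E)
  have 1: "card (insert x E - S) = Suc (card (E - S))" if "S \<in> Pow E" for S
    using that insert(1,2) by (subst insert_Diff_if) auto
  have 2: "insert x E - insert x S = E - S" for S
    using insert(2) by auto
  have fin: "finite S" "x \<notin> S" if "S \<in> Pow E" for S
    using that insert(1,2) finite_subset by auto
  have IH: "(\<Sum>S\<in>Pow E. t ^ card (E - S) * d (card (S \<inter> B)) (card (S - B)))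
    = bt2 t d (card (E \<inter> B)) (card (E - B))" for d by (rule insert.IH)
  show ?case
  proof (cases "x \<in> B")
    case True
    have "(\<Sum>S\<in>Pow (insert x E). t ^ card (insert x E - S) * d (card (S \<inter> B)) (card (S - B)))
      = (\<Sum>S\<in>Pow E. t * (t ^ card (E - S) * d (card (S \<inter> B)) (card (S - B))))
      + (\<Sum>S\<in>Pow E. t ^ card (E - S) * d (Suc (card (S \<inter> B))) (card (S - B)))"
      unfolding sum_Pow_insert[OF insert(1,2)] using True fin
      by (intro arg_cong2[of _ _ _ _ "(+)"] sum.cong) (auto simp: 1 2 insert_Diff_if mult_ac)
    also have "\<dots> = bt2 t d (Suc (card (E \<inter> B))) (card (E - B))"
      unfolding sum_distrib_left[symmetric] IH IH[of "\<lambda>j. d (Suc j)"] by (simp add: bt2_Suc_left)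
    finally show ?thesis using True insert(1,2) by (simp add: insert_Diff_if)
  next
    case False
    have "(\<Sum>S\<in>Pow (insert x E). t ^ card (insert x E - S) * d (card (S \<inter> B)) (card (S - B)))
      = (\<Sum>S\<in>Pow E. t * (t ^ card (E - S) * d (card (S \<inter> B)) (card (S - B))))
      + (\<Sum>S\<in>Pow E. t ^ card (E - S) * d (card (S \<inter> B)) (Suc (card (S - B))))"
      unfolding sum_Pow_insert[OF insert(1,2)] using False fin
      by (intro arg_cong2[of _ _ _ _ "(+)"] sum.cong) (auto simp: 1 2 insert_Diff_if mult_ac)
    also have "\<dots> = bt2 t d (card (E \<inter> B)) (Suc (card (E - B)))"
      unfolding sum_distrib_left[symmetric] IH IH[of "\<lambda>j k. d j (Suc k)"] by (simp add: bt2_Suc_right)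
    finally show ?thesis using False insert(1,2) by (simp add: insert_Diff_if)
  qed
qed

lemma sum_Pow_bt:
  assumes "finite E"
  shows "(\<Sum>S\<in>Pow E. t ^ card (E - S) * a (card S)) = bt t a (card E)"
  using sum_Pow_bt2[OF assms, of t "\<lambda>j k. a j" UNIV] by (simp add: bt2_def)

section \<open>Antidiagonal sums and their transforms\<close>

definition diag_incr :: "'r::comm_ring_1 \<Rightarrow> (nat \<Rightarrow> 'r) \<Rightarrow> nat \<Rightarrow> nat \<Rightarrow> 'r" where
  "diag_incr t a j k = t * a (j + k) - (a (Suc j) + t * a j) * a k"

text \<open>With \<open>b + c\<close> fixed, this function vanishes at \<open>b = 0\<close> and
  changes by \<open>diag_incr t a b c\<close> from \<open>(b, Suc c)\<close> to
  \<open>(Suc b, c)\<close>.\<close>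

definition diag_sum :: "'r::comm_ring_1 \<Rightarrow> (nat \<Rightarrow> 'r) \<Rightarrow> nat \<Rightarrow> nat \<Rightarrow> 'r" where
  "diag_sum t a b c = (\<Sum>j<b. diag_incr t a j (b + c - 1 - j))"

lemma diag_sum_0 [simp]: "diag_sum t a 0 c = 0"
  by (simp add: diag_sum_def)

lemma diag_sum_Suc: "diag_sum t a (Suc b) c = diag_sum t a b (Suc c) + diag_incr t a b c"
  by (simp add: diag_sum_def)

text \<open>By the recursion of \<open>bt\<close>, the combination
  \<open>a (Suc j) + t * a j\<close> transforms to a single value at \<open>Suc b\<close>. This is
  why the products in the KL formula have a second term and those in the Z formula have
  none.\<close>

lemma bt2_diag_incr:
  "bt2 t (diag_incr t a) b c = t * bt t a (b + c) - bt t a (Suc b) * bt t a c"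
proof -
  have "bt t (\<lambda>j. a (Suc j) + t * a j) b = bt t a (Suc b)"
    by (simp add: bt_add bt_mult_left)
  then show ?thesis
    using bt2_diff[of t "\<lambda>j k. t * a (j + k)" "\<lambda>j k. (a (Suc j) + t * a j) * a k" b c]
      bt2_plus_arg[of t "\<lambda>s. t * a s" b c]
    by (simp add: diag_incr_def[abs_def] bt2_prod bt_mult_left)
qed

text \<open>The terms with factor \<open>t\<close> in \<open>bt2_Suc_left\<close> and
  \<open>bt2_Suc_right\<close> agree, so the transforms at \<open>(Suc b, c)\<close> and
  \<open>(b, Suc c)\<close> differ by the transform of the increment.\<close>

lemma bt2_diag_sum:
  "bt2 t (diag_sum t a) b c =
    (\<Sum>j<b. t * bt t a (b + c - 1) - bt t a (Suc j) * bt t a (b + c - 1 - j))"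
proof (induction b arbitrary: c)
  case 0
  have "bt t (\<lambda>_. 0) c = 0" using bt_mult_left[of t 0 "\<lambda>_. 0" c] by simp
  moreover have "diag_sum t a 0 = (\<lambda>_. 0)" by (simp add: fun_eq_iff)
  ultimately show ?case by (simp add: bt2_def)
next
  case (Suc b)
  have "bt2 t (diag_sum t a) (Suc b) c
    = bt2 t (diag_sum t a) b (Suc c) + bt2 t (diag_incr t a) b c"
    using bt2_add[of t "\<lambda>j k. diag_sum t a j (Suc k)" "diag_incr t a" b c]
    by (simp add: bt2_Suc_left bt2_Suc_right diag_sum_Suc[abs_def])
  then show ?case by (simp add: Suc bt2_diag_incr)
qed

section \<open>Palindromicity, KL polynomials and uniform matroids\<close>

lemma palindromic_0 [simp]: "palindromic d 0"
  by (simp add: palindromic_def)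

lemma palindromic_add: "palindromic d p \<Longrightarrow> palindromic d q \<Longrightarrow> palindromic d (p + q)"
  unfolding palindromic_def coeff_add by (metis degree_add_le)

lemma palindromic_diff: "palindromic d p \<Longrightarrow> palindromic d q \<Longrightarrow> palindromic d (p - q)"
  unfolding palindromic_def coeff_diff by (metis degree_diff_le)

lemma palindromic_sum: "(\<And>i. i \<in> A \<Longrightarrow> palindromic d (p i)) \<Longrightarrow> palindromic d (\<Sum>i\<in>A. p i)"
  by (induction A rule: infinite_finite_induct) (auto intro: palindromic_add)

lemma palindromic_mult:
  assumes "palindromic d p" "palindromic e q" shows "palindromic (d + e) (p * q)"
  unfolding palindromic_iff_poly
proof (intro allI impI)
  fix t :: real assume t: "t \<noteq> 0"
  have "map_poly real_of_int (p * q) = map_poly real_of_int p * map_poly real_of_int q"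
    by (rule poly_eqI) (simp add: coeff_map_poly coeff_mult)
  moreover have "t ^ d * poly (map_poly real_of_int p) (1 / t) = poly (map_poly real_of_int p) t"
    "t ^ e * poly (map_poly real_of_int q) (1 / t) = poly (map_poly real_of_int q) t"
    using assms t unfolding palindromic_iff_poly by blast+
  moreover have "t ^ (d + e) * (x * y) = (t ^ d * x) * (t ^ e * y)" for x y
    by (simp add: power_add)
  ultimately show "t ^ (d + e) * poly (map_poly real_of_int (p * q)) (1 / t) =
      poly (map_poly real_of_int (p * q)) t"
    by (simp only: poly_mult)
qed

lemma palindromic_of_nat_mult: "palindromic d p \<Longrightarrow> palindromic d (of_nat k * p)"
  by (induction k) (auto simp: distrib_right intro: palindromic_add)

text \<open>Reflection moves the indices below \<open>d / 2\<close> above it, where the degree bound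
  gives zero coefficients; this is what makes KL polynomials unique.\<close>

lemma palindromic_low_degree:
  assumes "palindromic d p" "2 * degree p < d" shows "p = 0"
proof (rule poly_eqI)
  fix i
  have high: "coeff p j = 0" if "d \<le> 2 * j" for j
    using assms(2) that by (intro coeff_eq_0) simp
  show "coeff p i = coeff 0 i"
  proof (cases "d \<le> 2 * i")
    case False
    then have "coeff p i = coeff p (d - i)"
      using assms(1)[unfolded palindromic_def, THEN conjunct2, rule_format, of i] by simp
    then show ?thesis using False high[of "d - i"] by simp
  qed (use high in simp)
qed

section \<open>Recognising KL polynomials through proper contractions\<close>

lemma flat_if_loopless_contract:
  assumes "F \<subseteq> ground M" "loopless (contract M F)" shows "flat M F"
  unfolding flat_def
proof (intro conjI ballI)
  fix e assume e: "e \<in> ground M - F"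
  then have "indep (contract M F) {e}"
    using assms by (auto intro: loopless_indep simp: ground_contract)
  then obtain B where B: "basis_of M F B" "indep M (insert e B)"
    by (auto simp: indep_contract)
  then have "card (insert e B) \<le> rank_of M (insert e F)"
    by (intro rank_of_ge) (auto simp: basis_of_def)
  moreover have "e \<notin> B" "finite B" using B e indep_finite by (auto simp: basis_of_def)
  ultimately show "rank_of M F < rank_of M (insert e F)"
    using card_basis_of[OF B(1)] by simp
qed (use assms in auto)

lemma KL_loop: "\<not> loopless M \<Longrightarrow> KL M = 0"
  and KL_rank_0: "loopless M \<Longrightarrow> rank M = 0 \<Longrightarrow> KL M = 1"
  and degree_KL: "loopless M \<Longrightarrow> rank M > 0 \<Longrightarrow> 2 * degree (KL M) < rank M"
  and palindromic_KL: "loopless M \<Longrightarrow> palindromic (rank M) (flat_sum KL M)"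
  using KL_assignment_KL unfolding KL_assignment_def by blast+

text \<open>Since KL vanishes on matroids with loops, nonflats contribute nothing and the sum over
  flats becomes a sum over all sets, indexed here by the complements.\<close>

lemma flat_sum_KL:
  "flat_sum KL M =
    (\<Sum>S\<in>Pow (ground M). [:0, 1:] ^ rank_of M (ground M - S) * KL (contract M (ground M - S)))"
proof -
  have "flat_sum KL M =
      (\<Sum>F\<in>Pow (ground M). [:0, 1:] ^ rank_of M F * KL (contract M F))"
    unfolding flat_sum_def
  proof (rule sum.mono_neutral_cong_left)
    show "\<forall>F\<in>Pow (ground M) - {F. flat M F}. [:0, 1:] ^ rank_of M F * KL (contract M F) = 0"
      using flat_if_loopless_contract KL_loop by force
  qed (auto simp: flat_def monom_altdef)
  also have "\<dots> =
    (\<Sum>S\<in>Pow (ground M). [:0, 1:] ^ rank_of M (ground M - S) * KL (contract M (ground M - S)))"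
    by (rule sum.reindex_bij_witness[of _ "\<lambda>S. ground M - S" "\<lambda>S. ground M - S"])
      (auto simp: double_diff)
  finally show ?thesis .
qed

text \<open>Here \<open>p\<close> replaces the contribution \<open>KL M\<close> of the empty flat,
  so \<open>KL M - p\<close> is palindromic of low degree and vanishes. The other terms involve
  proper contractions only and are open to induction.\<close>

lemma KL_eqI:
  assumes "loopless M" "rank M > 0" "2 * degree p < rank M"
    and "palindromic (rank M) (flat_sum KL M - KL M + p)"
  shows "KL M = p"
proof -
  have "palindromic (rank M) (flat_sum KL M - (flat_sum KL M - KL M + p))"
    using assms palindromic_KL by (intro palindromic_diff)
  then have "palindromic (rank M) (KL M - p)" by simp
  moreover have "2 * degree (KL M - p) < rank M"
    using degree_diff_le_max[of "KL M" p] degree_KL[of M] assms by simp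
  ultimately have "KL M - p = 0" by (rule palindromic_low_degree)
  then show ?thesis by simp
qed

lemma flat_sum_KL_minus_KL:
  "flat_sum KL M - KL M =
    (\<Sum>S\<in>Pow (ground M) - {ground M}.
      [:0, 1:] ^ rank_of M (ground M - S) * KL (contract M (ground M - S)))"
  unfolding flat_sum_KL
  by (subst sum.remove[of _ "ground M"]) (auto simp: contract_empty)

section \<open>Ranks, loops and contractions of uniform matroids\<close>

lemma ground_uniform_on: "finite E \<Longrightarrow> ground (uniform_on k E) = E"
  by transfer auto

lemma indep_uniform_on:
  "finite E \<Longrightarrow> indep (uniform_on k E) X \<longleftrightarrow> X \<subseteq> E \<and> card X \<le> k"
  by transfer auto

lemma rank_of_uniform_on:
  assumes "finite E" "A \<subseteq> E" shows "rank_of (uniform_on k E) A = min (card A) k"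
proof -
  obtain X where X: "X \<subseteq> A" "card X = min (card A) k"
    using obtain_subset_with_card_n[of "min (card A) k" A] by auto
  then have "min (card A) k \<le> rank_of (uniform_on k E) A"
    using rank_of_ge[of X A "uniform_on k E"] assms by (auto simp: indep_uniform_on)
  moreover obtain Y where Y: "Y \<subseteq> A" "indep (uniform_on k E) Y" "card Y = rank_of (uniform_on k E) A"
    using rank_of_attained by metis
  moreover have "card Y \<le> card A" using Y assms by (intro card_mono) (auto intro: finite_subset)
  ultimately show ?thesis using assms by (intro antisym) (auto simp: indep_uniform_on)
qed

lemma rank_uniform_on: "finite E \<Longrightarrow> rank (uniform_on k E) = min (card E) k"
  by (simp add: rank_def ground_uniform_on rank_of_uniform_on)

lemma loopless_uniform_on: "finite E \<Longrightarrow> loopless (uniform_on k E) \<longleftrightarrow> k > 0 \<or> E = {}"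
  by (auto simp: loopless_def loop_def ground_uniform_on indep_uniform_on)

lemma contract_uniform_on:
  assumes "finite E" "F \<subseteq> E"
  shows "contract (uniform_on k E) F = uniform_on (k - card F) (E - F)"
proof (rule matroid_eqI)
  let ?U = "uniform_on k E"
  have finF: "finite F" using assms finite_subset by auto
  \<comment> \<open>A basis of \<open>F\<close> uses up \<open>min (card F) k\<close> of the rank;
    what is left is the truncated difference \<open>k - card F\<close>, which is 0 once
    \<open>F\<close> is spanning.\<close>
  have basis: "basis_of ?U F B \<longleftrightarrow> B \<subseteq> F \<and> card B = min (card F) k" for B
    using card_basis_of[of ?U F B] basis_ofI[of B F ?U] assms
    by (auto simp: rank_of_uniform_on indep_uniform_on basis_of_def)
  have card_Un: "card (X \<union> B) = card X + card B" if "X \<subseteq> E - F" "B \<subseteq> F" for X B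
    using that assms finF by (intro card_Un_disjoint) (auto intro: finite_subset)
  fix X
  show "indep (contract ?U F) X \<longleftrightarrow> indep (uniform_on (k - card F) (E - F)) X"
  proof
    assume "indep (contract ?U F) X"
    then show "indep (uniform_on (k - card F) (E - F)) X"
      using assms card_Un[of X] by (auto simp: indep_contract indep_uniform_on ground_uniform_on basis)
  next
    assume X: "indep (uniform_on (k - card F) (E - F)) X"
    obtain B where B: "B \<subseteq> F" "card B = min (card F) k"
      using obtain_subset_with_card_n[of "min (card F) k" F] by auto
    have "card X \<le> k - card F" "X \<subseteq> E - F" using X assms by (auto simp: indep_uniform_on)
    then have "card (X \<union> B) \<le> k" using B card_Un[of X B] by simp
    then show "indep (contract ?U F) X"
      using X B assms by (auto simp: indep_contract indep_uniform_on ground_uniform_on basis)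
  qed
qed (use assms in \<open>auto simp: ground_contract ground_uniform_on\<close>)

text \<open>A bijection matches the proper contractions, so induction on the size equates all terms
  but that of the empty flat, and \<open>KL_eqI\<close> applies. The ground sets may have different
  types, so sets of naturals can serve as representatives.\<close>

lemma KL_uniform_on_cong:
  assumes "finite E" "finite E'" "card E = card E'"
  shows "KL (uniform_on k E) = KL (uniform_on k E')"
  using assms
proof (induction "card E" arbitrary: E E' k rule: less_induct)
  case less
  obtain f where f: "bij_betw f E E'"
    using less.prems finite_same_card_bij by blast
  have img: "card (f ` A) = card A" "f ` A \<subseteq> E'" if "A \<subseteq> E" for A
    using that f by (auto simp: bij_betw_def inj_on_subset intro!: card_image)
  have img_diff: "E' - f ` A = f ` (E - A)" if "A \<subseteq> E" for A
    using that f by (auto simp: bij_betw_def inj_on_def)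
  show ?case
  proof (cases "k > 0 \<and> E \<noteq> {}")
    case True
    then have E': "E' \<noteq> {}" using less.prems by auto
    have inj: "inj_on f E" and onto: "f ` E = E'" using f by (auto simp: bij_betw_def)
    have eq: "E = A" if "f ` A = E'" "A \<subseteq> E" for A
      using that inj onto inj_on_image_eq_iff[of f E E A] by auto
    have "bij_betw (image f) (Pow E - {E}) (Pow E' - {E'})"
      using bij_betw_Pow[OF f] onto eq by (intro bij_betw_DiffI) (auto simp: bij_betw_def)
    then have "(\<Sum>S\<in>Pow E' - {E'}. [:0, 1:] ^ min (card (E' - S)) k * KL (uniform_on (k - card (E' - S)) S))
        = (\<Sum>S\<in>Pow E - {E}. [:0, 1:] ^ min (card (E' - f ` S)) k * KL (uniform_on (k - card (E' - f ` S)) (f ` S)))"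
      by (rule sum.reindex_bij_betw[symmetric])
    also have "\<dots> = (\<Sum>S\<in>Pow E - {E}. [:0, 1:] ^ min (card (E - S)) k * KL (uniform_on (k - card (E - S)) S))"
    proof (rule sum.cong)
      fix S assume S: "S \<in> Pow E - {E}"
      then have "card S < card E" using less.prems by (intro psubset_card_mono) auto
      then have "KL (uniform_on m S) = KL (uniform_on m (f ` S))" for m
        using S less.prems img[of S] finite_subset[of S E] by (intro less.hyps) auto
      then show "[:0, 1:] ^ min (card (E' - f ` S)) k * KL (uniform_on (k - card (E' - f ` S)) (f ` S))
        = [:0, 1:] ^ min (card (E - S)) k * KL (uniform_on (k - card (E - S)) S)"
        using S img[of "E - S"] img_diff[of S] by simp
    qed simp
    finally have "flat_sum KL (uniform_on k E') - KL (uniform_on k E') =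
        flat_sum KL (uniform_on k E) - KL (uniform_on k E)"
      using less.prems unfolding flat_sum_KL_minus_KL
      by (simp add: ground_uniform_on rank_of_uniform_on contract_uniform_on double_diff)
    then have "flat_sum KL (uniform_on k E) - KL (uniform_on k E) + KL (uniform_on k E') =
        flat_sum KL (uniform_on k E')"
      by (metis diff_add_cancel)
    moreover have "rank (uniform_on k E') = rank (uniform_on k E)" "rank (uniform_on k E) > 0"
      "loopless (uniform_on k E)" "loopless (uniform_on k E')"
      using less.prems True by (auto simp: rank_uniform_on loopless_uniform_on)
    ultimately show ?thesis
      using palindromic_KL[of "uniform_on k E'"] degree_KL[of "uniform_on k E'"]
      by (intro KL_eqI) simp_all
  next
    \<comment> \<open>Either the ground sets are empty and both values are 1, or
      \<open>k = 0\<close> and loops make both values 0.\<close>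
    case False
    moreover have "E' = {} \<longleftrightarrow> E = {}" using less.prems by auto
    ultimately show ?thesis
      using less.prems by (cases "E = {}")
        (auto simp: KL_loop KL_rank_0 loopless_uniform_on rank_uniform_on)
  qed
qed

section \<open>Uniform matroids of corank one\<close>

definition KL1 :: "nat \<Rightarrow> int poly" where
  "KL1 n = KL (U (n - 1) n)"

definition Z1 :: "nat \<Rightarrow> int poly" where
  "Z1 n = Zpoly (U (n - 1) n)"

text \<open>The value at 0 accounts for the full ground set, the only flat whose rank is smaller than its
  cardinality; the transform below needs \<open>KL1 0\<close> to be read as \<open>1 / t\<close>.\<close>

definition kl_scaled :: "nat \<Rightarrow> int poly" where
  "kl_scaled n = (if n = 0 then 1 else [:0, 1:] * KL1 n)"

text \<open>The bracket in the theorem for \<open>r = n - b - 1\<close>. The parameter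
  \<open>b\<close> is the size of the complement of a stressed set with \<open>r + 1\<close>
  elements, hence of a colour class.\<close>

definition relax_KL :: "nat \<Rightarrow> nat \<Rightarrow> int poly" where
  "relax_KL n b = of_nat (b - 1) * KL1 (n - 1)
     - (\<Sum>a = 2..b. KL1 (n - a) * (KL1 a + [:0, 1:] * KL1 (a - 1)))"

definition relax_Z :: "nat \<Rightarrow> nat \<Rightarrow> int poly" where
  "relax_Z n b = of_nat (b - 1) * Z1 (n - 1) - (\<Sum>a = 2..b. Z1 a * Z1 (n - a))"

lemma KL1_1 [simp]: "KL1 (Suc 0) = 0"
  by (simp add: KL1_def KL_loop loopless_uniform_on lessThan_Suc)

lemma Z1_1 [simp]: "Z1 (Suc 0) = 0"
  by (simp add: Z1_def Zpoly_def loopless_uniform_on lessThan_Suc)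

lemma relax_KL_1 [simp]: "relax_KL n (Suc 0) = 0"
  by (simp add: relax_KL_def)

lemma relax_Z_1 [simp]: "relax_Z n (Suc 0) = 0"
  by (simp add: relax_Z_def)

lemma relax_KL_Suc:
  "b \<ge> 1 \<Longrightarrow> relax_KL n (Suc b) =
    relax_KL n b + KL1 (n - 1) - KL1 (n - Suc b) * (KL1 (Suc b) + [:0, 1:] * KL1 b)"
  by (cases b) (simp_all add: relax_KL_def algebra_simps)

lemma relax_Z_Suc:
  "b \<ge> 1 \<Longrightarrow> relax_Z n (Suc b) = relax_Z n b + Z1 (n - 1) - Z1 (Suc b) * Z1 (n - Suc b)"
  by (cases b) (simp_all add: relax_Z_def algebra_simps)

lemma KL_uniform_on_corank1: "finite S \<Longrightarrow> KL (uniform_on (card S - 1) S) = KL1 (card S)"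
  unfolding KL1_def by (rule KL_uniform_on_cong) auto

text \<open>A set \<open>F\<close> with nonempty complement \<open>S\<close> has rank
  \<open>card F\<close>, and contracting it gives the uniform matroid of corank one on
  \<open>S\<close>; this matches one summand of the transform.\<close>

lemma bt_kl_scaled: "2 \<le> n \<Longrightarrow> bt [:0, 1:] kl_scaled n = [:0, 1:] * Z1 n"
proof -
  assume n: "2 \<le> n"
  let ?E = "{..<n}"
  have "[:0, 1:] * Z1 n = (\<Sum>S\<in>Pow ?E. [:0, 1:] *
      ([:0, 1:] ^ rank_of (U (n - 1) n) (?E - S) * KL (contract (U (n - 1) n) (?E - S))))"
    using n by (simp add: Z1_def Zpoly_def loopless_uniform_on flat_sum_KL ground_uniform_on sum_distrib_left)
  also have "\<dots> = (\<Sum>S\<in>Pow ?E. [:0, 1:] ^ card (?E - S) * kl_scaled (card S))"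
  proof (rule sum.cong)
    fix S assume S: "S \<in> Pow ?E"
    then have fin: "finite S" using finite_subset by auto
    show "[:0, 1:] * ([:0, 1:] ^ rank_of (U (n - 1) n) (?E - S) * KL (contract (U (n - 1) n) (?E - S)))
        = [:0, 1:] ^ card (?E - S) * kl_scaled (card S)"
    proof (cases "S = {}")
      case True
      have "[:0, 1:] * [:0, 1:] ^ (n - 1) = ([:0, 1:] :: int poly) ^ n"
        using n by (cases n) auto
      then show ?thesis using True
        by (simp add: rank_of_uniform_on contract_uniform_on KL_rank_0 loopless_uniform_on
            rank_uniform_on kl_scaled_def)
    next
      case False
      then have "card S > 0" using fin by (simp add: card_gt_0_iff)
      moreover have "card S \<le> n" using S card_mono[of ?E S] by simp
      moreover have "card (?E - S) = n - card S" using S fin by (simp add: card_Diff_subset)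
      ultimately have "min (card (?E - S)) (n - 1) = card (?E - S)"
        "n - 1 - card (?E - S) = card S - 1" "card S \<noteq> 0" by auto
      then show ?thesis
        using S fin by (simp add: rank_of_uniform_on contract_uniform_on kl_scaled_def
            KL_uniform_on_corank1 double_diff del: One_nat_def)
    qed
  qed simp
  also have "\<dots> = bt [:0, 1:] kl_scaled n"
    using sum_Pow_bt[of ?E] by simp
  finally show ?thesis by simp
qed

text \<open>At 1 the transform is the variable, whereas \<open>Z1 1\<close> is 0 by the loop
  convention. This discrepancy is what cancels the first increment in the transformed sums.\<close>

lemma bt_kl_scaled_0: "bt [:0, 1:] kl_scaled 0 = 1"
  and bt_kl_scaled_1: "bt [:0, 1:] kl_scaled (Suc 0) = [:0, 1:]"
  by (simp_all add: kl_scaled_def)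

text \<open>For positive arguments, \<open>diag_incr\<close> of \<open>kl_scaled\<close> is the
  square of the variable times the step of \<open>relax_KL\<close> from \<open>b\<close> to
  \<open>Suc b\<close>. At \<open>j = 0\<close> it vanishes because \<open>kl_scaled 0 = 1\<close>
  and \<open>KL1 1 = 0\<close>.\<close>

lemma diag_sum_kl:
  assumes "1 \<le> b" "b < n"
  shows "diag_sum [:0, 1:] kl_scaled b (n - b) = [:0, 1:] ^ 2 * relax_KL n b"
  using assms
proof (induction b rule: nat_induct_at_least)
  case base
  then show ?case by (simp add: diag_sum_def diag_incr_def kl_scaled_def)
next
  case (Suc b)
  have "diag_sum [:0, 1:] kl_scaled (Suc b) (n - Suc b) =
      [:0, 1:] ^ 2 * relax_KL n b + diag_incr [:0, 1:] kl_scaled b (n - Suc b)"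
    using Suc by (simp add: diag_sum_Suc Suc_diff_Suc)
  also have "diag_incr [:0, 1:] kl_scaled b (n - Suc b) = [:0, 1:] ^ 2 *
      (KL1 (n - 1) - KL1 (n - Suc b) * (KL1 (Suc b) + [:0, 1:] * KL1 b))"
    using Suc by (simp add: diag_incr_def kl_scaled_def power2_eq_square algebra_simps
        del: mult_pCons_left mult_pCons_right)
  finally show ?case using Suc by (simp add: relax_KL_Suc algebra_simps)
qed

text \<open>The last increment has \<open>k = 0\<close>, where \<open>kl_scaled 0 = 1\<close>
  reduces it to \<open>- kl_scaled n\<close>. The leading term of the formula is thereby also
  expressed through \<open>diag_sum\<close>.\<close>

lemma diag_sum_kl_0:
  assumes "2 \<le> n"
  shows "diag_sum [:0, 1:] kl_scaled n 0 + kl_scaled n = [:0, 1:] ^ 2 * relax_KL n (n - 1)"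
proof -
  obtain b where b: "n = Suc b" "1 \<le> b" using assms by (cases n) auto
  have "diag_incr [:0, 1:] kl_scaled b 0 = - kl_scaled n"
    by (simp add: diag_incr_def b kl_scaled_def)
  then show ?thesis
    using diag_sum_kl[of b n] b by (simp add: diag_sum_Suc)
qed

text \<open>The transformed increment at \<open>j = 0\<close> vanishes since the transform at 1 is
  the variable. The bound \<open>b + 2 \<le> n\<close> keeps all arguments in the later increments
  at least 2, where \<open>bt_kl_scaled\<close> applies.\<close>

lemma bt2_diag_sum_kl:
  assumes "1 \<le> b" "b + 2 \<le> n"
  shows "bt2 [:0, 1:] (diag_sum [:0, 1:] kl_scaled) b (n - b) = [:0, 1:] ^ 2 * relax_Z n b"
proof -
  have "(\<Sum>j<b. [:0, 1:] * bt [:0, 1:] kl_scaled (n - 1)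
      - bt [:0, 1:] kl_scaled (Suc j) * bt [:0, 1:] kl_scaled (n - 1 - j)) = [:0, 1:] ^ 2 * relax_Z n b"
    using assms
  proof (induction b rule: nat_induct_at_least)
    case base
    then show ?case by (simp add: bt_kl_scaled_1 del: bt.simps)
  next
    case (Suc b)
    then show ?case
      by (simp add: relax_Z_Suc bt_kl_scaled power2_eq_square algebra_simps
          del: bt.simps mult_pCons_left mult_pCons_right)
  qed
  then show ?thesis using assms by (simp add: bt2_diag_sum)
qed

lemma bt2_diag_sum_kl_0:
  assumes "3 \<le> n"
  shows "bt2 [:0, 1:] (diag_sum [:0, 1:] kl_scaled) n 0 + bt [:0, 1:] kl_scaled n
    = [:0, 1:] ^ 2 * relax_Z n (n - 1)"
proof -
  obtain b where b: "n = Suc (Suc b)" "1 \<le> b"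
    using assms by (cases n; cases "n - 1") auto
  \<comment> \<open>Of the last two increments, the one at \<open>j = n - 2\<close> vanishes because
    the transform at 1 is the variable; the one at \<open>j = n - 1\<close> contains the transform
    at 0, which is 1.\<close>
  have "bt2 [:0, 1:] (diag_sum [:0, 1:] kl_scaled) n 0 =
      bt2 [:0, 1:] (diag_sum [:0, 1:] kl_scaled) b (n - b)
      + [:0, 1:] * bt [:0, 1:] kl_scaled (n - 1) - bt [:0, 1:] kl_scaled n"
    using b by (simp add: bt2_diag_sum bt_kl_scaled_0 bt_kl_scaled_1 del: bt.simps mult_pCons_left mult_pCons_right)
  also have "bt2 [:0, 1:] (diag_sum [:0, 1:] kl_scaled) b (n - b) = [:0, 1:] ^ 2 * relax_Z n b"
    using b by (intro bt2_diag_sum_kl) auto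
  finally show ?thesis
    using b by (simp add: bt_kl_scaled relax_Z_Suc power2_eq_square algebra_simps
        del: bt.simps mult_pCons_left mult_pCons_right)
qed

section \<open>Degree and palindromicity of the correction terms\<close>

lemma degree_KL1: "1 \<le> n \<Longrightarrow> degree (KL1 n) \<le> (n - 2) div 2"
proof (cases "n = 1")
  case False
  assume "1 \<le> n"
  then show ?thesis
    using False degree_KL[of "U (n - 1) n"]
    by (simp add: KL1_def loopless_uniform_on rank_uniform_on)
qed simp

text \<open>The factors of a product have degree at most \<open>(n - a - 2) div 2\<close> and
  \<open>(a - 1) div 2\<close>, which add up to at most \<open>(n - 3) div 2\<close>, strictly below
  half of \<open>n - 2\<close>.\<close>

lemma degree_relax_KL:
  assumes "1 \<le> b" "b < n" "3 \<le> n"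
  shows "2 * degree (relax_KL n b) < n - 2"
proof -
  have "degree (of_nat (b - 1) * KL1 (n - 1)) \<le> (n - 3) div 2"
  proof -
    have "1 \<le> n - 1" using assms by simp
    from degree_KL1[OF this] show ?thesis
      using degree_mult_le[of "of_nat (b - 1)" "KL1 (n - 1)"]
      by (simp add: numeral_3_eq_3 del: of_nat_diff)
  qed
  moreover have "degree (\<Sum>a = 2..b. KL1 (n - a) * (KL1 a + [:0, 1:] * KL1 (a - 1))) \<le> (n - 3) div 2"
  proof (rule degree_sum_le)
    fix a assume a: "a \<in> {2..b}"
    show "degree (KL1 (n - a) * (KL1 a + [:0, 1:] * KL1 (a - 1))) \<le> (n - 3) div 2"
    proof (cases "n - a = 1")
      \<comment> \<open>The excluded value \<open>n - a = 1\<close> would break the bound through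
        truncated subtraction, but there the product is 0 because \<open>KL1 1 = 0\<close>.\<close>
      case False
      have "degree (KL1 a + [:0, 1:] * KL1 (a - 1)) \<le> (a - 1) div 2"
      proof (rule degree_add_le)
        show "degree (KL1 a) \<le> (a - 1) div 2"
          using degree_KL1[of a] a by (auto elim!: order_trans intro: div_le_mono)
        show "degree ([:0, 1:] * KL1 (a - 1)) \<le> (a - 1) div 2"
        proof (cases "a = 2")
          case False
          have "1 \<le> a - 1" using a by auto
          from degree_KL1[OF this] have "degree (KL1 (a - 1)) + 1 \<le> (a - 3) div 2 + 1"
            by (simp add: numeral_3_eq_3)
          also have "\<dots> = (a - 1) div 2" using False a unfolding atLeastAtMost_iff by presburger
          finally show ?thesis
            using degree_mult_le[of "[:0, 1:]" "KL1 (a - 1)"] by simp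
        qed simp
      qed
      moreover have "degree (KL1 (n - a)) \<le> (n - a - 2) div 2"
        using a assms by (intro degree_KL1) auto
      ultimately have "degree (KL1 (n - a) * (KL1 a + [:0, 1:] * KL1 (a - 1)))
          \<le> (n - a - 2) div 2 + (a - 1) div 2"
        by (intro order_trans[OF degree_mult_le] add_mono)
      also have "\<dots> \<le> ((n - a - 2) + (a - 1)) div 2" by linarith
      also have "(n - a - 2) + (a - 1) = n - 3" using a assms False by auto
      finally show ?thesis .
    qed simp
  qed simp
  ultimately have "degree (relax_KL n b) \<le> (n - 3) div 2"
    unfolding relax_KL_def by (rule degree_diff_le)
  then show ?thesis using assms by auto
qed

lemma palindromic_Z1: "1 \<le> n \<Longrightarrow> palindromic (n - 1) (Z1 n)"
  using palindromic_KL[of "U (n - 1) n"]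
  by (auto simp: Z1_def Zpoly_def rank_uniform_on)

lemma palindromic_relax_Z:
  assumes "b < n" "2 \<le> n" shows "palindromic (n - 2) (relax_Z n b)"
proof -
  have "palindromic (n - 2) (Z1 a * Z1 (n - a))" if "a \<in> {2..b}" for a
  proof -
    have "(a - 1) + (n - a - 1) = n - 2" "1 \<le> a" "1 \<le> n - a" using that assms by auto
    then show ?thesis
      using palindromic_mult[OF palindromic_Z1[of a] palindromic_Z1[of "n - a"]] by metis
  qed
  moreover have "palindromic (n - 2) (Z1 (n - 1))"
    using palindromic_Z1[of "n - 1"] assms by (simp add: numeral_2_eq_2)
  ultimately show ?thesis
    unfolding relax_Z_def by (intro palindromic_diff palindromic_of_nat_mult palindromic_sum)
qed

section \<open>Coloopless matroids of corank two\<close>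

text \<open>The colours are the parallel classes of the dual matroid, which has rank two.\<close>

definition coloured_by :: "'a matroid \<Rightarrow> ('a \<Rightarrow> 'b) \<Rightarrow> bool" where
  "coloured_by M c \<longleftrightarrow>
     (\<forall>X. indep M X \<longleftrightarrow> X \<subseteq> ground M \<and> (\<exists>x\<in>ground M - X. \<exists>y\<in>ground M - X. c x \<noteq> c y))"

abbreviation colour_class :: "'a matroid \<Rightarrow> ('a \<Rightarrow> 'b) \<Rightarrow> 'b \<Rightarrow> 'a set" where
  "colour_class M c i \<equiv> {x \<in> ground M. c x = i}"

lemma coloured_by_indep:
  "coloured_by M c \<Longrightarrow> indep M X \<longleftrightarrow>
    X \<subseteq> ground M \<and> (\<exists>x\<in>ground M - X. \<exists>y\<in>ground M - X. c x \<noteq> c y)"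
  unfolding coloured_by_def by blast

lemma coloured_by_two_colours: "coloured_by M c \<Longrightarrow> \<exists>x\<in>ground M. \<exists>y\<in>ground M. c x \<noteq> c y"
  using coloured_by_indep[of M c "{}"] by simp

section \<open>Ranks and contractions of coloured matroids\<close>

lemma rank_of_indep: "indep M F \<Longrightarrow> rank_of M F = card F"
proof -
  assume F: "indep M F"
  then have "basis_of M F F" by (simp add: basis_of_def)
  then show ?thesis by (simp add: card_basis_of)
qed

lemma card_le_if_coloured_indep:
  assumes "coloured_by M c" "indep M X" shows "card X + 2 \<le> card (ground M)"
proof -
  obtain x y where xy: "x \<in> ground M - X" "y \<in> ground M - X" "c x \<noteq> c y"
    using assms coloured_by_indep by metis
  have "card (ground M - X) = card (ground M) - card X"
    using assms by (intro card_Diff_subset) (auto dest: indep_finite indep_subset_ground)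
  moreover have "card {x, y} \<le> card (ground M - X)"
    using xy by (intro card_mono) auto
  moreover have "card {x, y} = 2" using xy by (metis card_2_iff)
  ultimately show ?thesis by simp
qed

lemma rank_coloured:
  assumes "coloured_by M c" shows "rank M = card (ground M) - 2"
proof -
  obtain x y where xy: "x \<in> ground M" "y \<in> ground M" "c x \<noteq> c y"
    using coloured_by_two_colours[OF assms] by auto
  then have "card {x, y} = 2" by (metis card_2_iff)
  then have "card (ground M - {x, y}) = card (ground M) - 2"
    using xy by (simp add: card_Diff_subset)
  moreover have "indep M (ground M - {x, y})"
    using xy by (auto simp: coloured_by_indep[OF assms])
  ultimately have "card (ground M) - 2 \<le> rank M"
    unfolding rank_def using rank_of_ge[of "ground M - {x, y}" "ground M" M] by simp
  moreover obtain X where "indep M X" "card X = rank M"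
    using rank_of_attained unfolding rank_def by metis
  ultimately show ?thesis using card_le_if_coloured_indep[OF assms, of X] by simp
qed

text \<open>The complement of a set \<open>S\<close> meeting two colours is independent, hence its
  own only basis. Adding \<open>X\<close> to it leaves out exactly \<open>S - X\<close>, so
  independence in the contraction is read off the same colouring.\<close>

lemma coloured_contract_indep:
  assumes "coloured_by M c" "S \<subseteq> ground M" "x \<in> S" "y \<in> S" "c x \<noteq> c y"
  shows "coloured_by (contract M (ground M - S)) c"
    and "ground (contract M (ground M - S)) = S"
    and "rank_of M (ground M - S) = card (ground M - S)"
proof -
  let ?F = "ground M - S"
  have "x \<in> ground M - ?F" "y \<in> ground M - ?F" using assms by auto
  then have F: "indep M ?F" using assms(5) coloured_by_indep[OF assms(1), of ?F] by blast
  then show "rank_of M ?F = card ?F" by (rule rank_of_indep)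
  show gr: "ground (contract M ?F) = S" using assms by (auto simp: ground_contract)
  have "basis_of M ?F B \<longleftrightarrow> B = ?F" for B
  proof
    assume B: "basis_of M ?F B"
    have sub: "B \<subseteq> ?F" using B by (simp add: basis_of_def)
    moreover have "e \<in> B" if e: "e \<in> ?F" for e
    proof (rule ccontr)
      assume "e \<notin> B"
      moreover have "indep M (insert e B)" using e sub by (intro indep_mono[OF F]) simp
      ultimately show False using B e by (simp add: basis_of_def)
    qed
    ultimately show "B = ?F" by (intro equalityI subsetI) auto
  qed (use F in \<open>simp add: basis_of_def\<close>)
  then have *: "indep (contract M ?F) X \<longleftrightarrow> X \<subseteq> S \<and> indep M (X \<union> ?F)" for X
    using assms by (auto simp: indep_contract double_diff)
  have "indep (contract M ?F) X \<longleftrightarrow> X \<subseteq> S \<and> (\<exists>x\<in>S - X. \<exists>y\<in>S - X. c x \<noteq> c y)" for X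
  proof (cases "X \<subseteq> S")
    case True
    then have "ground M - (X \<union> ?F) = S - X" "X \<union> ?F \<subseteq> ground M" using assms by auto
    then show ?thesis using True coloured_by_indep[OF assms(1), of "X \<union> ?F"] * by simp
  qed (use * in simp)
  then show "coloured_by (contract M ?F) c"
    unfolding coloured_by_def gr by blast
qed

lemma card_le_pred_iff:
  assumes "finite S" "S \<noteq> {}" "X \<subseteq> S" shows "card X \<le> card S - 1 \<longleftrightarrow> X \<noteq> S"
proof (cases "X = S")
  case False
  then have "card X < card S" using assms by (intro psubset_card_mono) auto
  then show ?thesis using False by simp
qed (use assms in \<open>simp add: card_gt_0_iff not_le\<close>)

text \<open>Since \<open>S\<close> has one colour, \<open>ground M - S\<close> is dependent, but
  releasing one element \<open>f\<close> of another colour makes it independent. A proper subset of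
  \<open>S\<close> can be added to this basis: some element of \<open>S\<close> and \<open>f\<close>
  stay outside.\<close>

lemma coloured_contract_mono:
  assumes M: "coloured_by M c" and S: "S \<subseteq> colour_class M c i" "S \<noteq> {}"
  shows "contract M (ground M - S) = uniform_on (card S - 1) S"
    and "rank_of M (ground M - S) = card (ground M - S) - 1"
proof -
  let ?F = "ground M - S"
  have finS: "finite S" using S(1) finite_subset[of S "ground M"] by auto
  have S_sub: "S \<subseteq> ground M" using S by auto
  obtain s where s: "s \<in> S" using S by auto
  then have cs: "c s = i" using S by auto
  obtain f where f: "f \<in> ground M" "c f \<noteq> i"
    using coloured_by_two_colours[OF M] by metis
  then have fF: "f \<in> ?F" using S by auto
  have "ground M - ?F = S" using S_sub by auto
  moreover have "c x = c y" if "x \<in> S" "y \<in> S" for x y using that S by auto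
  ultimately have notF: "\<not> indep M ?F" unfolding coloured_by_indep[OF M] by metis
  have ind: "indep M (?F - {f})"
  proof -
    have "s \<in> ground M - (?F - {f})" "f \<in> ground M - (?F - {f})" using s f S_sub by auto
    then show ?thesis using f cs unfolding coloured_by_indep[OF M] by blast
  qed
  have "?F - (?F - {f}) = {f}" "insert f (?F - {f}) = ?F" using fF by auto
  then have basis_f: "basis_of M ?F (?F - {f})"
    using ind notF by (simp add: basis_of_def)
  then show rk: "rank_of M ?F = card ?F - 1"
    using card_basis_of[OF basis_f] fF by simp
  show "contract M ?F = uniform_on (card S - 1) S"
  proof (rule matroid_eqI)
    fix X
    have sub: "card X \<le> card S - 1 \<longleftrightarrow> X \<noteq> S" if "X \<subseteq> S"
      by (rule card_le_pred_iff[OF finS S(2) that])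
    have "indep (contract M ?F) X \<longleftrightarrow> X \<subseteq> S \<and> X \<noteq> S"
    proof
      assume "indep (contract M ?F) X"
      then obtain B where B: "X \<subseteq> S" "basis_of M ?F B" "indep M (X \<union> B)"
        using S_sub by (auto simp: indep_contract double_diff)
      have "X \<noteq> S"
      proof
        \<comment> \<open>All of \<open>S\<close> together with a basis of \<open>?F\<close> would
          omit only one element, but an independent set omits at least two.\<close>
        assume "X = S"
        have "finite B" "S \<inter> B = {}" using B(2) indep_finite by (auto simp: basis_of_def)
        with \<open>X = S\<close> have "card S + card B + 2 \<le> card (ground M)"
          using card_le_if_coloured_indep[OF M B(3)] card_Un_disjoint[of S B] finS by simp
        moreover have "card ?F = card (ground M) - card S" "card ?F > 0"
          using finS S_sub fF card_gt_0_iff[of ?F] by (auto simp: card_Diff_subset)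
        ultimately show False using card_basis_of[OF B(2)] rk by simp
      qed
      with B show "X \<subseteq> S \<and> X \<noteq> S" by simp
    next
      assume X: "X \<subseteq> S \<and> X \<noteq> S"
      then obtain x where x: "x \<in> S" "x \<notin> X" by auto
      have "x \<in> ground M - (X \<union> (?F - {f}))" "f \<in> ground M - (X \<union> (?F - {f}))"
        "X \<union> (?F - {f}) \<subseteq> ground M" "c x \<noteq> c f"
        using x X f S fF S_sub by auto
      then have "indep M (X \<union> (?F - {f}))"
        unfolding coloured_by_indep[OF M] by blast
      then show "indep (contract M ?F) X"
        using X basis_f S_sub by (auto simp: indep_contract double_diff)
    qed
    then show "indep (contract M ?F) X \<longleftrightarrow> indep (uniform_on (card S - 1) S) X"
      using sub finS by (auto simp: indep_uniform_on)
  qed (use S_sub finS in \<open>auto simp: ground_contract ground_uniform_on\<close>)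
qed

section \<open>Sizes of colour classes\<close>

lemma card_colour_class:
  assumes "coloured_by M c" "i \<in> c ` ground M"
  shows "1 \<le> card (colour_class M c i)" "card (colour_class M c i) < card (ground M)"
proof -
  show "1 \<le> card (colour_class M c i)"
    using assms by (force simp: card_gt_0_iff Suc_le_eq)
  obtain f where "f \<in> ground M" "c f \<noteq> i"
    using coloured_by_two_colours[OF assms(1)] by metis
  then have "colour_class M c i \<subset> ground M" by blast
  then show "card (colour_class M c i) < card (ground M)"
    by (intro psubset_card_mono) auto
qed

text \<open>If only one element lay outside the class, its removal would leave a single colour, so
  it would be a loop.\<close>

lemma card_colour_class_loopless:
  assumes "coloured_by M c" "loopless M" "i \<in> c ` ground M"
  shows "card (colour_class M c i) + 2 \<le> card (ground M)"
proof -
  obtain e where e: "e \<in> ground M" "c e \<noteq> i"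
    using coloured_by_two_colours[OF assms(1)] by auto
  then have "indep M {e}" using assms loopless_indep by auto
  then obtain x y where xy: "x \<in> ground M - {e}" "y \<in> ground M - {e}" "c x \<noteq> c y"
    using coloured_by_indep[OF assms(1)] by auto
  then obtain e' where e': "e' \<in> ground M - {e}" "c e' \<noteq> i" by metis
  have "card (colour_class M c i \<union> {e, e'}) \<le> card (ground M)"
    using e e' by (intro card_mono) auto
  moreover have "card (colour_class M c i \<union> {e, e'}) = card (colour_class M c i) + card {e, e'}"
    using e e' by (intro card_Un_disjoint) auto
  moreover have "card {e, e'} = 2" using e' by auto
  ultimately show ?thesis by simp
qed

section \<open>Colourings from parallelism in the dual\<close>

lemma coloured_if_corank_2:
  assumes "corank M = 2" "\<forall>e. \<not> coloop M e"
  shows "\<exists>c :: 'a \<Rightarrow> 'a set. coloured_by (M :: 'a matroid) c"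
proof -
  let ?E = "ground M"
  have rk: "rank M + 2 = card ?E" using assms(1) by (simp add: corank_def)
  \<comment> \<open>On the ground set, \<open>R x y\<close> says that \<open>{x, y}\<close> is a
    basis of the dual, which has rank two. Then \<open>c x\<close> is the parallel class of
    \<open>x\<close>.\<close>
  define R where "R x y \<longleftrightarrow> indep M (?E - {x, y})" for x y
  define c where "c x = {y \<in> ?E. \<not> R x y}" for x
  have sym: "R x y \<longleftrightarrow> R y x" for x y by (simp add: R_def insert_commute)
  have card_le: "card X \<le> rank M" if "indep M X" for X
    unfolding rank_def using that by (intro rank_of_ge) (auto dest: indep_subset_ground)
  have irrefl: "\<not> R x x" if "x \<in> ?E" for x
  proof
    assume "R x x"
    then have "card (?E - {x}) \<le> rank M" using card_le by (simp add: R_def)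
    then show False using that rk by simp
  qed
  \<comment> \<open>An independent set extends to a basis, whose complement is a pair related by
    \<open>R\<close>.\<close>
  have basis_ex: "\<exists>x\<in>?E - X. \<exists>y\<in>?E - X. x \<noteq> y \<and> R x y" if X: "indep M X" for X
  proof -
    obtain Y where Y: "indep M Y" "X \<subseteq> Y" "card Y = rank M"
    proof -
      have "\<exists>Y. indep M Y \<and> X \<subseteq> Y \<and> card Y = rank M"
        using X
      proof (induction "rank M - card X" arbitrary: X)
        case 0
        then show ?case using card_le[of X] by (intro exI[of _ X]) auto
      next
        case (Suc k)
        obtain Z where Z: "indep M Z" "card Z = rank M"
          using rank_of_attained unfolding rank_def by metis
        have "card X < card Z" using Suc(2) Z by simp
        then obtain e where e: "e \<in> Z - X" "indep M (insert e X)"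
          using indep_augment[OF Suc(3) Z(1)] by blast
        then have "k = rank M - card (insert e X)"
          using Suc(2) indep_finite[OF Suc(3)] by auto
        then show ?case using Suc(1)[OF _ e(2)] by blast
      qed
      then show ?thesis using that by blast
    qed
    have YE: "Y \<subseteq> ?E" using Y by (simp add: indep_subset_ground)
    then have "card (?E - Y) = 2"
      using Y rk by (simp add: card_Diff_subset indep_finite)
    then obtain x y where xy: "?E - Y = {x, y}" "x \<noteq> y" by (meson card_2_iff)
    then have "Y = ?E - {x, y}" using YE by auto
    then have "R x y" using Y by (simp add: R_def)
    moreover have "x \<in> ?E - X" "y \<in> ?E - X" using xy Y by auto
    ultimately show ?thesis using xy by blast
  qed
  \<comment> \<open>The absence of coloops enters here: some basis avoids \<open>y\<close>, so
    \<open>y\<close> lies in the complementary pair.\<close>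
  have partner: "\<exists>w\<in>?E. w \<noteq> y \<and> R y w" if y: "y \<in> ?E" for y
  proof -
    obtain B where B: "basis_of M ?E B" "y \<notin> B"
      using assms(2) y by (auto simp: coloop_def)
    have cB: "card B = rank M" using card_basis_of[OF B(1)] by (simp add: rank_def)
    have "indep M B" "B \<subseteq> ?E" using B by (auto simp: basis_of_def)
    then have "card (?E - B) = 2"
      using cB rk by (simp add: card_Diff_subset indep_finite)
    then obtain u v where uv: "?E - B = {u, v}" "u \<noteq> v" by (meson card_2_iff)
    have "B = ?E - {u, v}" using uv \<open>B \<subseteq> ?E\<close> by auto
    then have "R u v" using \<open>indep M B\<close> by (simp add: R_def)
    moreover have "y \<in> {u, v}" using uv y B by blast
    moreover have "R v u" using \<open>R u v\<close> sym by simp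
    moreover have "u \<in> ?E" "v \<in> ?E" using uv(1) by blast+
    ultimately show ?thesis using uv(2) by auto
  qed
  \<comment> \<open>Augmenting \<open>?E - {x, y, z}\<close> from the basis
    \<open>?E - {y, w}\<close> can only add \<open>x\<close> or \<open>z\<close>, which yields
    \<open>R y z\<close> or \<open>R x y\<close>.\<close>
  have trans: "\<not> R x z" if tr: "x \<in> ?E" "y \<in> ?E" "z \<in> ?E" "\<not> R x y" "\<not> R y z" for x y z
  proof
    assume xz: "R x z"
    obtain w where w: "w \<in> ?E" "w \<noteq> y" "R y w" using partner[OF tr(2)] by auto
    have "x \<noteq> z" "x \<noteq> y" "y \<noteq> z" using xz irrefl tr by auto
    then have c3: "card (?E - {x, y, z}) = card ?E - 3"
      using tr by (subst card_Diff_subset) auto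
    have "card {x, y, z} \<le> card ?E" using tr by (intro card_mono) auto
    then have "3 \<le> card ?E" using \<open>x \<noteq> z\<close> \<open>x \<noteq> y\<close> \<open>y \<noteq> z\<close> by simp
    moreover have "card (?E - {y, w}) = card ?E - 2"
      using w tr by (subst card_Diff_subset) auto
    ultimately have "card (?E - {x, y, z}) < card (?E - {y, w})" using c3 by simp
    moreover have "indep M (?E - {x, y, z})"
      using xz unfolding R_def by (rule indep_mono) auto
    ultimately obtain e where e: "e \<in> (?E - {y, w}) - (?E - {x, y, z})"
      "indep M (insert e (?E - {x, y, z}))"
      using indep_augment w(3) unfolding R_def by metis
    then consider "e = x" | "e = z" by auto
    then show False
    proof cases
      case 1
      then have "insert e (?E - {x, y, z}) = ?E - {y, z}"
        using tr \<open>x \<noteq> z\<close> \<open>x \<noteq> y\<close> by auto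
      then show ?thesis using e(2) tr by (simp add: R_def)
    next
      case 2
      then have "insert e (?E - {x, y, z}) = ?E - {x, y}"
        using tr \<open>x \<noteq> z\<close> \<open>y \<noteq> z\<close> by auto
      then show ?thesis using e(2) tr by (simp add: R_def)
    qed
  qed
  have c_eq: "c x = c y \<longleftrightarrow> \<not> R x y" if "x \<in> ?E" "y \<in> ?E" for x y
    using that irrefl trans[of x y] trans[of y x] sym unfolding c_def by blast
  have "indep M X \<longleftrightarrow> X \<subseteq> ?E \<and> (\<exists>x\<in>?E - X. \<exists>y\<in>?E - X. c x \<noteq> c y)" for X
  proof
    assume "indep M X"
    then show "X \<subseteq> ?E \<and> (\<exists>x\<in>?E - X. \<exists>y\<in>?E - X. c x \<noteq> c y)"
      using basis_ex[of X] c_eq indep_subset_ground[of M X] by blast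
  next
    assume X: "X \<subseteq> ?E \<and> (\<exists>x\<in>?E - X. \<exists>y\<in>?E - X. c x \<noteq> c y)"
    then obtain x y where xy: "x \<in> ?E - X" "y \<in> ?E - X" "R x y" using c_eq by blast
    then have "X \<subseteq> ?E - {x, y}" using X by auto
    then show "indep M X" using xy(3) indep_mono unfolding R_def by blast
  qed
  then show ?thesis unfolding coloured_by_def by blast
qed

lemma coloured_uniform:
  assumes "2 \<le> n" shows "coloured_by (U (n - 2) n) id"
proof -
  have "card X \<le> n - 2 \<longleftrightarrow> (\<exists>x\<in>{..<n} - X. \<exists>y\<in>{..<n} - X. x \<noteq> y)" if "X \<subseteq> {..<n}" for X
  proof -
    have "card X \<le> n" using card_mono[OF _ that] by simp
    then have "card X \<le> n - 2 \<longleftrightarrow> 2 \<le> card ({..<n} - X)"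
      using that assms by (simp add: card_Diff_subset finite_subset) linarith
    also have "\<dots> \<longleftrightarrow> (\<exists>x\<in>{..<n} - X. \<exists>y\<in>{..<n} - X. x \<noteq> y)"
      using card_le_Suc0_iff_eq[of "{..<n} - X"] by force
    finally show ?thesis .
  qed
  then show ?thesis
    by (auto simp: coloured_by_def indep_uniform_on ground_uniform_on)
qed

section \<open>Stressed subsets as complements of colour classes\<close>

lemma ground_restrict: "ground (restrict M A) = ground M \<inter> A"
  by transfer auto

lemma indep_restrict: "indep (restrict M A) X \<longleftrightarrow> indep M X \<and> X \<subseteq> A"
  by transfer auto

text \<open>Nullity one forces a complement of a single colour. Uniformity of the restriction makes
  \<open>A - {y}\<close> independent for every \<open>y\<close> in \<open>A\<close>, so no such
  \<open>y\<close> has that colour. Conversely, for the complement of a class both restriction and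
  contraction are uniform of corank one.\<close>

lemma stressed_iff_colour_class:
  assumes M: "coloured_by M c"
  shows "stressed M A \<and> card A = rank_of M A + 1 \<longleftrightarrow>
    (\<exists>i\<in>c ` ground M. A = ground M - colour_class M c i)"
proof
  assume A: "stressed M A \<and> card A = rank_of M A + 1"
  let ?S = "ground M - A"
  have AE: "A \<subseteq> ground M" using A by (simp add: stressed_def)
  then have finA: "finite A" by (rule finite_subset) simp
  have "\<not> indep M A" using A rank_of_indep by force
  then have mono: "c x = c y" if "x \<in> ?S" "y \<in> ?S" for x y
    using that AE unfolding coloured_by_indep[OF M] by blast
  have "A \<noteq> ground M"
  proof
    assume "A = ground M"
    then have "card (ground M) = card (ground M) - 2 + 1"
      using A rank_coloured[OF M] by (simp add: rank_def)
    moreover obtain x y where "x \<in> ground M" "y \<in> ground M" "c x \<noteq> c y"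
      using coloured_by_two_colours[OF M] by auto
    then have "card {x, y} \<le> card (ground M)" "card {x, y} = 2"
      by (auto intro: card_mono) (metis card_2_iff)
    ultimately show False by simp
  qed
  then obtain s where s: "s \<in> ?S" using AE by auto
  have notA: "y \<notin> A" if y: "y \<in> ground M" "c y = c s" for y
  proof
    assume yA: "y \<in> A"
    have "uniform (restrict M A)" using A by (simp add: stressed_def)
    then obtain k where k: "restrict M A = uniform_on k (ground (restrict M A))"
      unfolding uniform_def by (elim exE conjE)
    have gr: "ground (restrict M A) = A" using AE by (auto simp: ground_restrict)
    have unif: "indep M X \<longleftrightarrow> card X \<le> k" if "X \<subseteq> A" for X
      using that indep_restrict[of M A X] indep_uniform_on[OF finA, of k X]
      unfolding k[unfolded gr] by blast
    obtain B where "B \<subseteq> A" "indep M B" "card B = rank_of M A"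
      using rank_of_attained by metis
    then have "rank_of M A \<le> k" using unif by auto
    then have "card (A - {y}) \<le> k" using yA finA A by simp
    then have "indep M (A - {y})" using unif by auto
    then obtain u v where "u \<in> ground M - (A - {y})" "v \<in> ground M - (A - {y})" "c u \<noteq> c v"
      using coloured_by_indep[OF M] by blast
    moreover have "c w = c s" if "w \<in> ground M - (A - {y})" for w
      using that mono[of w s] s y by (cases "w = y") auto
    ultimately show False by metis
  qed
  have "A = ground M - colour_class M c (c s)"
  proof (intro equalityI subsetI)
    show "x \<in> ground M - colour_class M c (c s)" if "x \<in> A" for x
      using that AE notA[of x] by auto
    show "x \<in> A" if "x \<in> ground M - colour_class M c (c s)" for x
      using that mono[OF _ s, of x] by blast
  qed
  then show "\<exists>i\<in>c ` ground M. A = ground M - colour_class M c i" using s by blast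
next
  assume "\<exists>i\<in>c ` ground M. A = ground M - colour_class M c i"
  then obtain i where i: "i \<in> c ` ground M" and A: "A = ground M - colour_class M c i" by auto
  let ?S = "colour_class M c i"
  have S: "?S \<subseteq> ground M" "?S \<noteq> {}" using i by auto
  obtain s where s: "s \<in> ground M" "c s = i" using i by auto
  obtain f where f: "f \<in> ground M" "c f \<noteq> i"
    using coloured_by_two_colours[OF M] by auto
  have finA: "finite A" using A by simp
  have AE: "A \<subseteq> ground M" and fA: "f \<in> A" using f A by auto
  then have A0: "0 < card A" using finA by (auto simp: card_gt_0_iff)
  have con: "contract M A = uniform_on (card ?S - 1) ?S" and rk: "rank_of M A = card A - 1"
    using coloured_contract_mono[of M c ?S i, OF M subset_refl S(2)] unfolding A by this
  have res: "restrict M A = uniform_on (card A - 1) A"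
  proof (rule matroid_eqI)
    show "ground (restrict M A) = ground (uniform_on (card A - 1) A)"
      using A finA by (auto simp: ground_uniform_on ground_restrict)
    fix X
    have "indep (restrict M A) X \<longleftrightarrow> indep M X \<and> X \<subseteq> A"
      by (rule indep_restrict)
    also have "\<dots> \<longleftrightarrow> X \<subseteq> A \<and> X \<noteq> A"
    proof
      assume X: "indep M X \<and> X \<subseteq> A"
      then obtain x y where xy: "x \<in> ground M - X" "y \<in> ground M - X" "c x \<noteq> c y"
        unfolding coloured_by_indep[OF M] by (elim conjE bexE)
      then have "c x \<noteq> i \<or> c y \<noteq> i" by metis
      then have "x \<in> A \<or> y \<in> A" using xy unfolding A by simp
      then show "X \<subseteq> A \<and> X \<noteq> A" using X xy(1,2) by blast
    next
      assume X: "X \<subseteq> A \<and> X \<noteq> A"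
      then obtain x where x: "x \<in> A" "x \<notin> X" by auto
      then have "x \<in> ground M - X" "c x \<noteq> c s" using s(2) unfolding A by simp_all
      moreover have "s \<notin> A" using s(2) unfolding A by simp
      then have "s \<in> ground M - X" using X s(1) by blast
      moreover have "X \<subseteq> ground M" using X AE by blast
      ultimately have "indep M X" unfolding coloured_by_indep[OF M] by (intro conjI bexI)
      then show "indep M X \<and> X \<subseteq> A" using X by simp
    qed
    also have "\<dots> \<longleftrightarrow> X \<subseteq> A \<and> card X \<le> card A - 1"
      using card_le_pred_iff[OF finA _, of X] fA by (intro conj_cong) auto
    finally show "indep (restrict M A) X \<longleftrightarrow> indep (uniform_on (card A - 1) A) X"
      using finA by (simp add: indep_uniform_on)
  qed
  have "uniform (uniform_on (card X - 1) X)" if "finite X" for X :: "'a set"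
    unfolding uniform_def using that by (intro exI[of _ "card X - 1"]) (simp add: ground_uniform_on)
  then have "stressed M A"
    unfolding stressed_def con res using AE finA by simp
  then show "stressed M A \<and> card A = rank_of M A + 1" using rk A0 by simp
qed

lemma num_stressed_coloured:
  assumes "coloured_by M c"
  shows "num_stressed M r =
    card {i \<in> c ` ground M. card (ground M) = card (colour_class M c i) + r + 1}"
proof -
  let ?f = "\<lambda>i. ground M - colour_class M c i"
  let ?I = "{i \<in> c ` ground M. card (ground M) = card (colour_class M c i) + r + 1}"
  have cf: "card (?f i) = card (ground M) - card (colour_class M c i)" for i
    by (intro card_Diff_subset) auto
  have le: "card (colour_class M c i) \<le> card (ground M)" for i
    by (intro card_mono) auto
  have "{A. stressed M A \<and> rank_of M A = r \<and> card A = r + 1} = ?f ` ?I" (is "?L = ?R")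
  proof (intro set_eqI iffI)
    fix A assume A: "A \<in> ?L"
    then obtain i where i: "i \<in> c ` ground M" "A = ?f i"
      using stressed_iff_colour_class[OF assms, of A] by auto
    moreover have "card (?f i) = r + 1" using A i by simp
    ultimately show "A \<in> ?R" using cf[of i] le[of i] by auto
  next
    fix A assume "A \<in> ?R"
    then obtain i where i: "i \<in> ?I" "A = ?f i" by blast
    then have "stressed M A \<and> card A = rank_of M A + 1"
      using stressed_iff_colour_class[OF assms, of A] by auto
    then show "A \<in> ?L" using i cf[of i] by auto
  qed
  moreover have "inj_on ?f ?I" by (auto simp: inj_on_def)
  ultimately show ?thesis unfolding num_stressed_def by (simp only: card_image)
qed

text \<open>Colours are grouped by \<open>r\<close>: a class of size \<open>b\<close> among
  \<open>n\<close> elements gives \<open>r = n - b - 1\<close>, which is at most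
  \<open>n - 2\<close> because classes are nonempty.\<close>

lemma sum_num_stressed:
  fixes g :: "nat \<Rightarrow> 'b::comm_semiring_1"
  assumes M: "coloured_by M c"
  shows "(\<Sum>r\<le>card (ground M) - 2. of_nat (num_stressed M r) * g r) =
    (\<Sum>i\<in>c ` ground M. g (card (ground M) - card (colour_class M c i) - 1))"
proof -
  let ?n = "card (ground M)" and ?C = "c ` ground M"
  let ?r = "\<lambda>i. ?n - card (colour_class M c i) - 1"
  have "of_nat (num_stressed M r) * g r = (\<Sum>i | i \<in> ?C \<and> ?r i = r. g (?r i))" for r
  proof -
    have "{i \<in> ?C. ?n = card (colour_class M c i) + r + 1} = {i \<in> ?C. ?r i = r}"
      using card_colour_class(2)[OF M] by force
    then show ?thesis by (simp add: num_stressed_coloured[OF M])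
  qed
  then have "(\<Sum>r\<le>?n - 2. of_nat (num_stressed M r) * g r) =
      (\<Sum>r\<le>?n - 2. \<Sum>i | i \<in> ?C \<and> ?r i = r. g (?r i))" by simp
  also have "\<dots> = (\<Sum>i\<in>?C. g (?r i))"
    using card_colour_class(1)[OF M] by (intro sum.group) force+
  finally show ?thesis .
qed

section \<open>The formulas\<close>

text \<open>The term \<open>relax_KL n (n - 1)\<close> stands for the KL polynomial of
  \<open>U (n - 2) n\<close>; that they agree follows by applying the formula to this
  matroid.\<close>

definition KL_formula :: "'a matroid \<Rightarrow> ('a \<Rightarrow> 'b) \<Rightarrow> int poly" where
  "KL_formula M c = (let n = card (ground M) in
     relax_KL n (n - 1) - (\<Sum>i\<in>c ` ground M. relax_KL n (card (colour_class M c i))))"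

definition Z_formula :: "'a matroid \<Rightarrow> ('a \<Rightarrow> 'b) \<Rightarrow> int poly" where
  "Z_formula M c = (let n = card (ground M) in
     relax_Z n (n - 1) - (\<Sum>i\<in>c ` ground M. relax_Z n (card (colour_class M c i))))"

text \<open>A matroid with a loop has exactly two colours, one of which occurs once; the loop convention
  and the two formulas then agree.\<close>

lemma formulas_loop:
  assumes M: "coloured_by M c" and loop: "\<not> loopless M"
  shows "KL_formula M c = 0" "Z_formula M c = 0"
proof -
  let ?n = "card (ground M)"
  obtain e where e: "e \<in> ground M" "\<not> indep M {e}"
    using loop by (auto simp: loopless_def loop_def)
  have same: "c x = c y" if "x \<in> ground M - {e}" "y \<in> ground M - {e}" for x y
    using e that coloured_by_indep[OF M, of "{e}"] by blast
  obtain f where f: "f \<in> ground M" "c f \<noteq> c e"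
    using coloured_by_two_colours[OF M] by metis
  have other: "c x = c f" if "x \<in> ground M" "x \<noteq> e" for x
    using same[of x f] that f by auto
  have img: "c ` ground M = {c e, c f}"
  proof (intro equalityI subsetI)
    show "i \<in> {c e, c f}" if "i \<in> c ` ground M" for i
      using that other by blast
  qed (use e f in auto)
  have "colour_class M c (c e) = {e}"
  proof (intro equalityI subsetI)
    show "x \<in> {e}" if "x \<in> colour_class M c (c e)" for x
      using that other[of x] f by (cases "x = e") auto
  qed (use e in auto)
  moreover have "colour_class M c (c f) = ground M - {e}"
  proof (intro equalityI subsetI)
    show "x \<in> colour_class M c (c f)" if "x \<in> ground M - {e}" for x
      using that other[of x] by simp
  qed (use f in auto)
  ultimately have "card (colour_class M c (c e)) = Suc 0" "card (colour_class M c (c f)) = ?n - 1"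
    using e by simp_all
  then show "KL_formula M c = 0" "Z_formula M c = 0"
    unfolding KL_formula_def Z_formula_def Let_def img using f by simp_all
qed

section \<open>Scaled formulas as functions of class sizes\<close>

lemma card_ground_coloured: "coloured_by M c \<Longrightarrow> 2 \<le> card (ground M)"
  using card_le_if_coloured_indep[of M c "{}"] by simp

text \<open>In this form every term depends only on sizes of traces on the classes and their
  complements, so a sum over subsets can be evaluated by \<open>bt2\<close>.\<close>

lemma KL_formula_scaled:
  assumes M: "coloured_by M c"
  shows "[:0, 1:] ^ 2 * KL_formula M c =
    diag_sum [:0, 1:] kl_scaled (card (ground M)) 0 + kl_scaled (card (ground M))
    - (\<Sum>i\<in>c ` ground M. diag_sum [:0, 1:] kl_scaled (card (colour_class M c i))
          (card (ground M) - card (colour_class M c i)))"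
proof -
  let ?n = "card (ground M)"
  have "(\<Sum>i\<in>c ` ground M. diag_sum [:0, 1:] kl_scaled (card (colour_class M c i))
          (?n - card (colour_class M c i)))
      = (\<Sum>i\<in>c ` ground M. [:0, 1:] ^ 2 * relax_KL ?n (card (colour_class M c i)))"
    using card_colour_class[OF M] by (intro sum.cong diag_sum_kl) auto
  moreover have "diag_sum [:0, 1:] kl_scaled ?n 0 + kl_scaled ?n = [:0, 1:] ^ 2 * relax_KL ?n (?n - 1)"
    by (intro diag_sum_kl_0 card_ground_coloured[OF M])
  ultimately show ?thesis
    by (simp only: KL_formula_def Let_def right_diff_distrib sum_distrib_left)
qed

lemma Z_formula_scaled:
  assumes M: "coloured_by M c" and loopless: "loopless M"
  shows "[:0, 1:] ^ 2 * Z_formula M c =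
    bt2 [:0, 1:] (diag_sum [:0, 1:] kl_scaled) (card (ground M)) 0 + bt [:0, 1:] kl_scaled (card (ground M))
    - (\<Sum>i\<in>c ` ground M. bt2 [:0, 1:] (diag_sum [:0, 1:] kl_scaled) (card (colour_class M c i))
          (card (ground M) - card (colour_class M c i)))"
proof -
  let ?n = "card (ground M)"
  obtain i where "i \<in> c ` ground M" using coloured_by_two_colours[OF M] by blast
  then have "3 \<le> ?n"
    using card_colour_class(1)[OF M, of i] card_colour_class_loopless[OF M loopless, of i] by linarith
  then have "bt2 [:0, 1:] (diag_sum [:0, 1:] kl_scaled) ?n 0 + bt [:0, 1:] kl_scaled ?n
      = [:0, 1:] ^ 2 * relax_Z ?n (?n - 1)"
    by (rule bt2_diag_sum_kl_0)
  moreover have "(\<Sum>i\<in>c ` ground M. bt2 [:0, 1:] (diag_sum [:0, 1:] kl_scaled)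
          (card (colour_class M c i)) (?n - card (colour_class M c i)))
      = (\<Sum>i\<in>c ` ground M. [:0, 1:] ^ 2 * relax_Z ?n (card (colour_class M c i)))"
    using card_colour_class(1)[OF M] card_colour_class_loopless[OF M loopless]
    by (intro sum.cong bt2_diag_sum_kl) auto
  ultimately show ?thesis
    by (simp only: Z_formula_def Let_def right_diff_distrib sum_distrib_left)
qed

text \<open>The empty flat contributes the candidate \<open>KL_formula M c\<close>; the other terms
  are known by induction or as uniform matroids of corank one or rank zero. All are values of one
  function \<open>psi\<close>, so the total is a binomial transform.\<close>

lemma KL_coloured_aux:
  assumes M: "coloured_by M c" and loopless: "loopless M"
    and IH: "\<And>N. coloured_by N c \<Longrightarrow> card (ground N) < card (ground M) \<Longrightarrow> KL N = KL_formula N c"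
  shows "flat_sum KL M - KL M + KL_formula M c = Z_formula M c"
proof -
  define t :: "int poly" where "t = [:0, 1:]"
  define E where "E = ground M"
  define D where "D = diag_sum t kl_scaled"
  define C where "C i = colour_class M c i" for i
  \<comment> \<open>For proper subsets, \<open>psi S\<close> is the KL polynomial of the contraction
    to \<open>S\<close> times \<open>t\<close> to the power 2 minus the nullity of
    \<open>E - S\<close>. One expression thus covers the nullities 0, 1 and 2.\<close>
  define psi where "psi S = D (card S) 0 + kl_scaled (card S)
      - (\<Sum>i\<in>c ` E. D (card (S \<inter> C i)) (card (S - C i)))" for S
  have finE: "finite E" by (simp add: E_def)
  have D0: "D 0 k = 0" for k by (simp add: D_def)
  have top: "t ^ 2 * KL_formula M c = psi E"
  proof -
    have "E \<inter> C i = C i" "card (E - C i) = card E - card (C i)" for i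
      using finE by (auto simp: E_def C_def card_Diff_subset)
    then show ?thesis
      using KL_formula_scaled[OF M] by (simp add: psi_def D_def C_def E_def t_def)
  qed
  have proper: "t ^ 2 * (t ^ rank_of M (E - S) * KL (contract M (E - S))) = t ^ card (E - S) * psi S"
    if S: "S \<in> Pow E - {E}" for S
  proof -
    have S_sub: "S \<subseteq> ground M" and finS: "finite S"
      using S finE by (auto simp: E_def intro: finite_subset)
    consider "S = {}" | "S \<noteq> {}" "\<exists>i. S \<subseteq> C i" | x y where "x \<in> S" "y \<in> S" "c x \<noteq> c y"
    proof (cases "\<exists>x\<in>S. \<exists>y\<in>S. c x \<noteq> c y")
      case False
      then have "S \<subseteq> C (c s)" if "s \<in> S" for s
        using that S_sub unfolding C_def by blast
      then show ?thesis using that(1,2) by blast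
    qed (use that(3) in blast)
    then show ?thesis
    proof cases
      case 1
      have "ground (contract M E) = {}" by (simp add: ground_contract E_def)
      then have "loopless (contract M E)" "rank (contract M E) = 0"
        by (auto simp: loopless_def loop_def rank_def)
      then have "KL (contract M E) = 1" by (rule KL_rank_0)
      moreover have "psi {} = 1" by (simp add: psi_def D0 kl_scaled_def)
      moreover have "rank_of M E = card E - 2" "2 \<le> card E"
        using rank_coloured[OF M] card_ground_coloured[OF M] by (simp_all add: E_def rank_def)
      moreover from this have "t ^ 2 * t ^ (card E - 2) = t ^ card E"
        by (metis le_add_diff_inverse power_add)
      ultimately show ?thesis using 1 by simp
    next
      case 2
      then obtain i where i: "S \<subseteq> C i" by blast
      obtain s where s: "s \<in> S" using 2 by blast
      have "KL (contract M (E - S)) = KL1 (card S)"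
        using coloured_contract_mono(1)[of M c S i] M i 2 KL_uniform_on_corank1[OF finS]
        by (simp add: C_def E_def)
      moreover have "rank_of M (E - S) = card (E - S) - 1"
        using coloured_contract_mono(2)[of M c S i] M i 2 by (simp add: C_def E_def)
      \<comment> \<open>Only the class containing \<open>S\<close> contributes, and its term cancels
        \<open>D (card S) 0\<close>.\<close>
      moreover have "psi S = t * KL1 (card S)"
      proof -
        have "D (card (S \<inter> C j)) (card (S - C j)) = (if j = i then D (card S) 0 else 0)" for j
        proof (cases "j = i")
          case True
          have "S \<inter> C i = S" using i by auto
          moreover have "card (S - C i) = 0" using i Diff_eq_empty_iff by (metis card.empty)
          ultimately show ?thesis using True by simp
        next
          case False
          then have "S \<inter> C j = {}" using i by (auto simp: C_def)
          then show ?thesis using False by (simp add: D0)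
        qed
        moreover have "i \<in> c ` E" using i s by (auto simp: C_def E_def)
        ultimately show ?thesis using 2 finE finS
          by (simp add: psi_def kl_scaled_def t_def)
      qed
      moreover have "card (E - S) \<noteq> 0"
        using S finE by auto
      then obtain k where "card (E - S) = Suc k" by (cases "card (E - S)") auto
      ultimately show ?thesis by (simp add: power2_eq_square)
    next
      case 3
      let ?N = "contract M (E - S)"
      have N: "coloured_by ?N c" "ground ?N = S" "rank_of M (E - S) = card (E - S)"
        using coloured_contract_indep[OF M S_sub 3] by (simp_all add: E_def)
      have "card S < card E" using S finE by (intro psubset_card_mono) auto
      then have "KL ?N = KL_formula ?N c" using N by (intro IH) (simp_all add: E_def)
      moreover have "t ^ 2 * KL_formula ?N c = psi S"
      proof -
        have cls: "{x \<in> S. c x = i} = S \<inter> C i" for i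
          using S_sub unfolding C_def by blast
        have card_diff: "card S - card (S \<inter> C i) = card (S - C i)" for i
          using finS by (simp add: card_Diff_subset_Int)
        \<comment> \<open>Colours absent from \<open>S\<close> may be included because
          \<open>D 0 k = 0\<close>.\<close>
        have "(\<Sum>i\<in>c ` S. D (card (S \<inter> C i)) (card (S - C i))) =
            (\<Sum>i\<in>c ` E. D (card (S \<inter> C i)) (card (S - C i)))"
        proof (rule sum.mono_neutral_left)
          show "\<forall>i\<in>c ` E - c ` S. D (card (S \<inter> C i)) (card (S - C i)) = 0"
          proof
            fix i assume "i \<in> c ` E - c ` S"
            then have "S \<inter> C i = {}" unfolding C_def by blast
            then show "D (card (S \<inter> C i)) (card (S - C i)) = 0" by (simp add: D0)
          qed
        qed (use finE S in auto)
        then show ?thesis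
          using KL_formula_scaled[OF N(1)] unfolding N(2) cls
          by (simp add: psi_def D_def t_def card_diff)
      qed
      ultimately show ?thesis using N(3) by (simp add: mult.left_commute)
    qed
  qed
  have "t ^ 2 * (flat_sum KL M - KL M + KL_formula M c) =
      (\<Sum>S\<in>Pow E - {E}. t ^ 2 * (t ^ rank_of M (E - S) * KL (contract M (E - S)))) + psi E"
    by (simp only: flat_sum_KL_minus_KL distrib_left top sum_distrib_left flip: E_def t_def)
  also have "\<dots> = (\<Sum>S\<in>Pow E - {E}. t ^ card (E - S) * psi S) + psi E"
    by (simp add: proper)
  also have "\<dots> = (\<Sum>S\<in>Pow E. t ^ card (E - S) * psi S)"
    using finE by (subst (2) sum.remove[of _ E]) auto
  \<comment> \<open>Exchanging the sums gives one transform per class, which splits \<open>E\<close>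
    into \<open>C i\<close> and its complement.\<close>
  also have "\<dots> = (\<Sum>S\<in>Pow E. t ^ card (E - S) * D (card S) 0)
      + (\<Sum>S\<in>Pow E. t ^ card (E - S) * kl_scaled (card S))
      - (\<Sum>i\<in>c ` E. \<Sum>S\<in>Pow E. t ^ card (E - S) * D (card (S \<inter> C i)) (card (S - C i)))"
    by (subst sum.swap) (simp add: psi_def algebra_simps sum.distrib sum_subtractf sum_distrib_left)
  also have "\<dots> = bt2 t D (card E) 0 + bt t kl_scaled (card E)
      - (\<Sum>i\<in>c ` E. bt2 t D (card (C i)) (card E - card (C i)))"
  proof -
    have "E \<inter> C i = C i" "card (E - C i) = card E - card (C i)" for i
      using finE by (auto simp: E_def C_def card_Diff_subset)
    moreover have "(\<Sum>S\<in>Pow E. t ^ card (E - S) * D (card S) 0) = bt2 t D (card E) 0"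
      using sum_Pow_bt2[OF finE, of t D UNIV] by simp
    ultimately show ?thesis
      by (simp add: sum_Pow_bt2[OF finE] sum_Pow_bt[OF finE])
  qed
  also have "\<dots> = t ^ 2 * Z_formula M c"
    using Z_formula_scaled[OF M loopless] by (simp add: D_def t_def E_def C_def)
  finally show ?thesis by (simp add: t_def)
qed

section \<open>Induction on the ground set and the uniform case\<close>

lemma KL_coloured:
  "coloured_by M c \<Longrightarrow> KL M = KL_formula M c"
proof (induction "card (ground M)" arbitrary: M rule: less_induct)
  case less
  note M = less.prems
  let ?n = "card (ground M)"
  show ?case
  proof (cases "loopless M")
    case True
    obtain i where "i \<in> c ` ground M" using coloured_by_two_colours[OF M] by blast
    then have n: "3 \<le> ?n"
      using card_colour_class(1)[OF M, of i] card_colour_class_loopless[OF M True, of i] by linarith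
    note rk = rank_coloured[OF M]
    have "palindromic (?n - 2) (Z_formula M c)"
      unfolding Z_formula_def Let_def using card_colour_class(2)[OF M] n
      by (intro palindromic_diff palindromic_sum palindromic_relax_Z) auto
    moreover have "2 * degree (KL_formula M c) < ?n - 2"
    proof -
      have deg: "degree (relax_KL ?n b) \<le> (?n - 3) div 2" if "1 \<le> b" "b < ?n" for b
        using degree_relax_KL[OF that n] by linarith
      have "degree (KL_formula M c) \<le> (?n - 3) div 2"
        unfolding KL_formula_def Let_def using card_colour_class[OF M] n
        by (intro degree_diff_le degree_sum_le deg) auto
      then show ?thesis using n by linarith
    qed
    moreover have "flat_sum KL M - KL M + KL_formula M c = Z_formula M c"
      using less by (intro KL_coloured_aux[OF M True]) auto
    ultimately show ?thesis
      using n rk True by (intro KL_eqI) simp_all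
  next
    case False
    then show ?thesis using formulas_loop[OF M] KL_loop by simp
  qed
qed

text \<open>With \<open>KL_coloured\<close> in place of the induction hypothesis, the left-hand side
  of \<open>KL_coloured_aux\<close> becomes the full flat sum.\<close>

lemma Zpoly_coloured: "coloured_by M c \<Longrightarrow> Zpoly M = Z_formula M c"
proof (cases "loopless M")
  case True
  assume M: "coloured_by M c"
  have "flat_sum KL M - KL M + KL_formula M c = Z_formula M c"
    by (rule KL_coloured_aux[OF M True KL_coloured])
  then show ?thesis using KL_coloured[OF M] True by (simp add: Zpoly_def)
qed (simp add: Zpoly_def formulas_loop)

text \<open>Distinct colours give classes of size one with zero correction, so only the leading term
  remains.\<close>

lemma KL_uniform_corank2: "2 \<le> n \<Longrightarrow> KL (U (n - 2) n) = relax_KL n (n - 1)"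
  and Zpoly_uniform_corank2: "2 \<le> n \<Longrightarrow> Zpoly (U (n - 2) n) = relax_Z n (n - 1)"
proof -
  assume n: "2 \<le> n"
  have "{x \<in> {..<n}. id x = i} = {i}" if "i < n" for i using that by auto
  then show "KL (U (n - 2) n) = relax_KL n (n - 1)" "Zpoly (U (n - 2) n) = relax_Z n (n - 1)"
    using KL_coloured[OF coloured_uniform[OF n]] Zpoly_coloured[OF coloured_uniform[OF n]]
    by (simp_all add: KL_formula_def Z_formula_def ground_uniform_on)
qed

theorem theorem9p9:
  fixes M :: "'a matroid" and n :: nat
  assumes "card (ground M) = n" and "corank M = 2" and "\<forall>e. \<not> coloop M e"
  shows "KL M = KL (U (n - 2) n)
      - (\<Sum>r\<le>n - 2. of_nat (num_stressed M r) *
          (of_nat (n - r - 2) * KL (U (n - 2) (n - 1))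
           - (\<Sum>a = 2..n - r - 1. KL (U (n - a - 1) (n - a)) *
                (KL (U (a - 1) a) + [:0, 1:] * KL (U (a - 2) (a - 1))))))
    \<and> Zpoly M = Zpoly (U (n - 2) n)
      - (\<Sum>r\<le>n - 2. of_nat (num_stressed M r) *
          (of_nat (n - r - 2) * Zpoly (U (n - 2) (n - 1))
           - (\<Sum>a = 2..n - r - 1. Zpoly (U (a - 1) a) * Zpoly (U (n - a - 1) (n - a)))))"
proof -
  obtain c :: "'a \<Rightarrow> 'a set" where c: "coloured_by M c"
    using coloured_if_corank_2[OF assms(2,3)] by blast
  have n: "2 \<le> n" using card_ground_coloured[OF c] assms(1) by simp
  have arith: "n - 1 - 1 = n - 2" "n - r - 1 - 1 = n - r - 2" "a - 1 - 1 = a - 2" for r a :: nat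
    by auto
  have KL: "of_nat (n - r - 2) * KL (U (n - 2) (n - 1))
      - (\<Sum>a = 2..n - r - 1. KL (U (n - a - 1) (n - a)) *
           (KL (U (a - 1) a) + [:0, 1:] * KL (U (a - 2) (a - 1)))) = relax_KL n (n - r - 1)" for r
    by (simp only: relax_KL_def KL1_def arith)
  have Z: "of_nat (n - r - 2) * Zpoly (U (n - 2) (n - 1))
      - (\<Sum>a = 2..n - r - 1. Zpoly (U (a - 1) a) * Zpoly (U (n - a - 1) (n - a)))
      = relax_Z n (n - r - 1)" for r
    by (simp only: relax_Z_def Z1_def arith)
  \<comment> \<open>For \<open>r = n - b - 1\<close> the parameter \<open>n - r - 1\<close> of the
    bracket is again the class size \<open>b\<close>.\<close>
  have "n - (n - card (colour_class M c i) - 1) - 1 = card (colour_class M c i)"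
    if "i \<in> c ` ground M" for i
    using card_colour_class[OF c that] assms(1) by linarith
  then have sum: "(\<Sum>r\<le>n - 2. of_nat (num_stressed M r) * g (n - r - 1)) =
      (\<Sum>i\<in>c ` ground M. g (card (colour_class M c i)))" for g :: "nat \<Rightarrow> int poly"
    using sum_num_stressed[OF c, of "\<lambda>r. g (n - r - 1)"] assms(1) by simp
  show ?thesis
    unfolding KL Z sum KL_uniform_corank2[OF n] Zpoly_uniform_corank2[OF n]
    using KL_coloured[OF c] Zpoly_coloured[OF c] assms(1)
    by (simp add: KL_formula_def Z_formula_def)
qed

end
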